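(* Consider $\min_{x\in\mathbb{R}^n} f(x)=\frac1N\sum_{i=1}^N f_i(x)$ subject to $c(x)=0$, and let $\{w_k\}_{k\in\mathbb{N}}$, $w_k=[x_k^T\ y_k^T]^T$, be the primal-dual iterates generated by the modified line search SQP algorithm described in the context. Suppose the assumptions (Smoothness), (Lagrangian), (Components), (Matrices) and (Growth) of the context hold. Suppose that for all $k\in\mathbb{N}$: (i) $\sum_{k=0}^\infty \frac{N-|S_k^f|}{N}<\infty$; (ii) $\sum_{k=0}^\infty \frac{N-|S_k^g|}{N}<\infty$; (iii) $|S_k^H|\ge\left(1-\frac{\bar\epsilon_H}{2(\kappa_2+\mu_2\kappa_H)}\right)N$, where $\bar\epsilon_H<2(1-\eta)\kappa_l$. Moreover, suppose that for sufficiently large $\hat k\in\mathbb{N}$ the following conditions are satisfied for all $k\ge\hat k$, where $t=k-\hat k$: (iv) $|S_k^g|\ge\left(1-\frac{\kappa_w\rho_0\beta_t^{t/2}}{4\Lambda(\kappa_1+\mu_1\kappa_g)}\right)N$ for some $\kappa_w\in\mathbb{R}_{>0}$, with $\beta_t<\beta_{t-1}$, $\beta_t\to0$, $\beta_1\le\rho_0^4$, and $$\rho_0:=\min\left\{\nu_\gamma,\ \frac{\nu_\gamma^2\mu_M}{4\kappa_M(1+2\kappa_{J^\dagger}\kappa_W)\max\{2\Lambda L_{\nabla\mathcal{L}},\nu_\gamma\}},\ \frac{\mu_M\Lambda}{2}\right\};$$ (v) $|S_{k+1}^H|>|S_k^H|$ whenever $|S_k^H|<N$ (and $|S_{k+1}^H|=N$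 if $|S_k^H|=N$), $\lim_{k\to\infty}|S_k^H|=N$, and $|S_{\hat k}^H|\ge\max\left\{\frac{8\Lambda(\kappa_2+\mu_2\kappa_H)-\rho_0}{8\Lambda(\kappa_2+\mu_2\kappa_H)}N,\,1\right\}$. Then $\|w_k-w^*\|\to0$ at an R-superlinear rate, i.e., there is a positive sequence $\{\xi_k\}$ such that $\|w_k-w^*\|\le\xi_k$ and $\xi_{k+1}/\xi_k\to0$.
   Context: Norms are Euclidean/spectral unless indicated. $f_i:\mathbb{R}^n\to\mathbb{R}$ and $c:\mathbb{R}^n\to\mathbb{R}^m$ ($m\le n$) are twice continuously differentiable. $g=\nabla f$, $H=\nabla^2 f$, $g_k=g(x_k)$, $H_k=H(x_k)$, $c_k=c(x_k)$, $J_k=\nabla c(x_k)^T$ (Jacobian, $m\times n$). $\mathcal{L}(x,y)=f(x)+y^Tc(x)$; $W_k=H_k+\sum_{i=1}^m y_{k,i}\nabla^2c_i(x_k)$. Subsampled quantities: for nonempty $S_k^f,S_k^g,S_k^H\subseteq\{1,\dots,N\}$, $\bar f_k(x)=\frac1{|S_k^f|}\sum_{i\in S_k^f}f_i(x)$, $\bar g_k=\frac1{|S_k^g|}\sum_{i\in S_k^g}\nabla f_i(x_k)$, $\bar H_k=\frac1{|S_k^H|}\sum_{i\in S_k^H}\nabla^2f_i(x_k)$, $\bar W_k=\bar H_k+\sum_i y_{k,i}\nabla^2c_i(x_k)$, $\bar M_k=\begin{bmatrix}\bar W_k&J_k^T\\ J_k&0\end{bmatrix}$. Assumptions. (Smoothness)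 $\mathcal{X}\subseteq\mathbb{R}^n$ is an open convex set containing the iterates $x_k$ and first trial points $x_k+\bar d_k$. Over $\mathcal{X}$: $f$ is twice continuously differentiable with $|f|\le\kappa_f$; $g$ is $L_1$-Lipschitz with $\|g\|\le\kappa_g$; $H$ is $L_2$-Lipschitz with $\|H\|\le\kappa_H$; $c$ is twice continuously differentiable with $\|c\|\le\kappa_c$; the Jacobian $\nabla c^T$ is bounded and $\Gamma_1$-Lipschitz; the Hessian of $c$ is $\Gamma_2$-Lipschitz; the singular values of $\nabla c^T$ are bounded away from zero so that $\|(J_kJ_k^T)^{-1}J_k\|\le\kappa_{J^\dagger}$. (Lagrangian) $w^*=[x^{*T}\ y^{*T}]^T$ is a first-order stationary point: $\nabla_x\mathcal{L}(x^*,y^* )=0$, $c(x^* )=0$. In some neighborhood of $w^*$ of radius $r>0$ the gradient and Hessian of $\mathcal{L}$ (as functions of $w=(x,y)$) are Lipschitz with constants $L_{\nabla\mathcal{L}}$ and $L_W$. (Components) There are $\kappa_0,\mu_0,\kappa_1,\mu_1,\kappa_2,\mu_2>0$ with $|f_i(x)|\le\kappa_0+\mu_0|f(x)|$, $\|\nabla f_i(x)\|\le\kappa_1+\mu_1\|\nabla f(x)\|$, $\|\nabla^2f_i(x)\|\le\kappa_2+\mu_2\|\nabla^2f(x)\|$ for all $x\in\mathcal{X}$, $i=1,\dots,N$. (Matrices) There are $\kappa_W,\zeta,\Lambda,\kappa_M>0$ such that for all $k$: $\|\bar W_k\|\le\kappa_W$; $u^T\bar W_ku\ge\zeta\|u\|^2$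 whenever $J_ku=0$; $\|\bar M_k^{-1}\|\le\Lambda$; $\|\bar M_k\|\le\kappa_M$. (Growth) There are $\kappa_d,\mu_M>0$ such that for all $k$ with $\|d_k\|\le\kappa_d$: $\frac{\mu_M}{2}\|w_k-w^*\|\le\left\|\begin{bmatrix}g_k+J_k^Ty_k\\c_k\end{bmatrix}\right\|$, where $(d_k,\delta_k)$ is the solution of the exact system $\begin{bmatrix}W_k&J_k^T\\ J_k&0\end{bmatrix}\begin{bmatrix}d_k\\\delta_k\end{bmatrix}=-\begin{bmatrix}g_k+J_k^Ty_k\\c_k\end{bmatrix}$. Errors: $\epsilon_{f_k}=2\frac{N-|S_k^f|}{N}(\kappa_0+\mu_0\kappa_f)$, $\epsilon_{g_k}=2\frac{N-|S_k^g|}{N}(\kappa_1+\mu_1\kappa_g)$. Merit function and model reduction: $\bar\phi(x,\tau)=\tau\bar f_k(x)+\|c(x)\|_1$ at iteration $k$; $\Delta l(x_k,\tau,\bar g_k,\bar d_k)=-\tau\bar g_k^T\bar d_k+\|c_k\|_1$. Algorithm. Input: $x_0\in\mathbb{R}^n$, $y_0\in\mathbb{R}^m$, $\bar\tau_{-1}>0$, $\gamma_0>0$, $\nu_\alpha,\nu_\gamma,\epsilon_\tau,\sigma,\eta\in(0,1)$. For each $k\in\mathbb{N}$: 1. Choose samples and compute $\bar f_k,\bar g_k,\bar H_k$; compute $(\bar d_k,\bar\delta_k)$ from $\bar M_k\begin{bmatrix}\bar d_k\\\bar\delta_k\end{bmatrix}=-\begin{bmatrix}\bar g_k+J_k^Ty_k\\c_k\end{bmatrix}$.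 2. Let $q_k=\bar g_k^T\bar d_k+\max\{\bar d_k^T\bar W_k\bar d_k,0\}$. Set $\bar\tau_k^{trial}=\infty$ if $q_k\le0$, else $\bar\tau_k^{trial}=(1-\sigma)\|c_k\|_1/q_k$. Set $\bar\tau_k=\bar\tau_{k-1}$ if $\bar\tau_{k-1}\le\bar\tau_k^{trial}$, else $\bar\tau_k=(1-\epsilon_\tau)\bar\tau_k^{trial}$. 3. Conditions on a step size $\alpha$: (A) $\bar\phi(x_k+\alpha\bar d_k,\bar\tau_k)\le\bar\phi(x_k,\bar\tau_k)-\eta\alpha\Delta l(x_k,\bar\tau_k,\bar g_k,\bar d_k)+\epsilon_{A_k}$; (B) $\bar\phi(x_k+\alpha\bar d_k,\bar\tau_k)\le\bar\phi(x_k,\bar\tau_k)-\eta\alpha\Delta l(x_k,\bar\tau_k,\bar g_k,\bar d_k)+\frac12\alpha^2\bar\tau_k\bar d_k^T\bar H_k\bar d_k+\frac12\alpha^2\sum_{i=1}^m|\bar d_k^T\nabla^2c_i(x_k)\bar d_k|+\epsilon_{A_k}$, with $\epsilon_{A_k}=\bar\tau_k\left(\kappa_{J^\dagger}\kappa_c+\zeta^{-1}(\kappa_g+\epsilon_{g_k}+\kappa_W\kappa_{J^\dagger}\kappa_c)\right)\epsilon_{g_k}+2\bar\tau_k\epsilon_{f_k}$. If $\|\bar d_k\|>\gamma_k$: starting from $\alpha=1$, replace $\alpha$ by $\nu_\alpha\alpha$ until (A) holds; set $\bar\alpha_k=\alpha$, $\gamma_{k+1}=\gamma_k$. If $\|\bar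 d_k\|\le\gamma_k$ and (A) holds with $\alpha=1$: set $\bar\alpha_k=1$, $\gamma_{k+1}=\gamma_k$. Otherwise: starting from $\alpha=1$, replace $\alpha$ by $\nu_\alpha\alpha$ until (B) holds; set $\bar\alpha_k=\alpha$, $\gamma_{k+1}=\nu_\gamma\gamma_k$. 4. $x_{k+1}=x_k+\bar\alpha_k\bar d_k$, $y_{k+1}=y_k+\bar\delta_k$. $\kappa_l>0$ denotes a constant (which exists under these assumptions) with $\Delta l(x_k,\bar\tau_k,\bar g_k,\bar d_k)\ge\kappa_l\bar\tau_k\|\bar d_k\|^2$ for all $k$. *)

theory Defs
  imports "HOL-Analysis.Analysis"
begin

text \<open>The library norm on matrices is the Frobenius norm, hence a separate name for the
  spectral norm.\<close>

definition spectral_norm :: "real^'a^'b \<Rightarrow> real"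
  where "spectral_norm A = onorm (\<lambda>v. A *v v)"

text \<open>For an \<open>m \<times> n\<close> matrix this yields its \<open>min m n\<close> singular values (as a set, zero
  included exactly when the rank is deficient).\<close>

definition singular_value :: "real^'a^'b \<Rightarrow> real \<Rightarrow> bool"
  where "singular_value A s \<longleftrightarrow>
    0 \<le> s \<and> (\<exists>u v. norm u = 1 \<and> norm v = 1 \<and> A *v v = s *\<^sub>R u \<and> transpose A *v u = s *\<^sub>R v)"

definition norm1 :: "real^'a \<Rightarrow> real"
  where "norm1 v = (\<Sum>i\<in>UNIV. \<bar>v $ i\<bar>)"

definition gradient :: "(real^'a \<Rightarrow> real) \<Rightarrow> real^'a \<Rightarrow> real^'a"
  where "gradient f x = (THE D. GDERIV f x :> D)"

definition hessian :: "(real^'a \<Rightarrow> real) \<Rightarrow> real^'a \<Rightarrow> real^'a^'a"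
  where "hessian f x = jacobian (gradient f) (at x)"

text \<open>Intended for open \<open>S\<close>.\<close>

definition twice_cont_diff_on :: "(real^'a) set \<Rightarrow> (real^'a \<Rightarrow> real) \<Rightarrow> bool"
  where "twice_cont_diff_on S f \<longleftrightarrow>
    (\<forall>x\<in>S. f differentiable (at x)) \<and>
    (\<forall>x\<in>S. gradient f differentiable (at x)) \<and>
    continuous_on S (hessian f)"

text \<open>Lipschitz continuity of a matrix-valued map with respect to the spectral norm
  (\<^const>\<open>lipschitz_on\<close> would use the Frobenius norm).\<close>

definition spectral_lipschitz_on :: "real \<Rightarrow> (real^'a) set \<Rightarrow> (real^'a \<Rightarrow> real^'b^'c) \<Rightarrow> bool"
  where "spectral_lipschitz_on L S A \<longleftrightarrow>
    0 \<le> L \<and> (\<forall>x\<in>S. \<forall>z\<in>S. spectral_norm (A x - A z) \<le> L * norm (x - z))"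

text \<open>Primal-dual vectors \<open>w = [x; y]\<close> live in \<open>real^('n + 'm)\<close>.\<close>

definition stack :: "real^'n \<Rightarrow> real^'m \<Rightarrow> real^('n::finite + 'm::finite)"
  where "stack x y = (\<chi> i. case i of Inl j \<Rightarrow> x $ j | Inr j \<Rightarrow> y $ j)"

definition primal :: "real^('n::finite + 'm::finite) \<Rightarrow> real^'n"
  where "primal w = (\<chi> j. w $ Inl j)"

definition dual :: "real^('n::finite + 'm::finite) \<Rightarrow> real^'m"
  where "dual w = (\<chi> j. w $ Inr j)"

text \<open>The block matrix \<open>[W, J\<^sup>T; J, 0]\<close>.\<close>

definition kkt_matrix :: "real^'n^'n \<Rightarrow> real^'n^'m \<Rightarrow> real^('n::finite + 'm::finite)^('n::finite + 'm::finite)"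
  where "kkt_matrix W J = (\<chi> i j.
    case i of
      Inl a \<Rightarrow> (case j of Inl b \<Rightarrow> W $ a $ b | Inr b \<Rightarrow> transpose J $ a $ b)
    | Inr a \<Rightarrow> (case j of Inl b \<Rightarrow> J $ a $ b | Inr b \<Rightarrow> 0))"

definition lagrangian :: "(real^'n \<Rightarrow> real) \<Rightarrow> (real^'n \<Rightarrow> real^'m) \<Rightarrow> real^'n \<Rightarrow> real^'m \<Rightarrow> real"
  where "lagrangian f c x y = f x + y \<bullet> c x"

definition average :: "nat set \<Rightarrow> (nat \<Rightarrow> 'a::real_vector) \<Rightarrow> 'a"
  where "average S F = (1 / real (card S)) *\<^sub>R (\<Sum>i\<in>S. F i)"

definition merit :: "(real^'n \<Rightarrow> real) \<Rightarrow> (real^'n \<Rightarrow> real^'m) \<Rightarrow> real^'n \<Rightarrow> real \<Rightarrow> real"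
  where "merit F c x \<tau> = \<tau> * F x + norm1 (c x)"

definition model_reduction :: "(real^'n \<Rightarrow> real^'m) \<Rightarrow> real^'n \<Rightarrow> real \<Rightarrow> real^'n \<Rightarrow> real^'n \<Rightarrow> real"
  where "model_reduction c x \<tau> g d = - \<tau> * (g \<bullet> d) + norm1 (c x)"

definition cond_A ::
  "(real^'n \<Rightarrow> real) \<Rightarrow> (real^'n \<Rightarrow> real^'m) \<Rightarrow> real \<Rightarrow> real^'n \<Rightarrow> real \<Rightarrow> real^'n \<Rightarrow> real^'n \<Rightarrow> real
    \<Rightarrow> real \<Rightarrow> bool"
  where "cond_A F c \<eta> x \<tau> g d e \<alpha> \<longleftrightarrow>
    merit F c (x + \<alpha> *\<^sub>R d) \<tau> \<le> merit F c x \<tau> - \<eta> * \<alpha> * model_reduction c x \<tau> g d + e"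

definition cond_B ::
  "(real^'n \<Rightarrow> real) \<Rightarrow> (real^'n \<Rightarrow> real^'m) \<Rightarrow> real \<Rightarrow> real^'n \<Rightarrow> real \<Rightarrow> real^'n \<Rightarrow> real^'n^'n
    \<Rightarrow> real^'n \<Rightarrow> real \<Rightarrow> real \<Rightarrow> bool"
  where "cond_B F c \<eta> x \<tau> g H d e \<alpha> \<longleftrightarrow>
    merit F c (x + \<alpha> *\<^sub>R d) \<tau> \<le> merit F c x \<tau> - \<eta> * \<alpha> * model_reduction c x \<tau> g d
      + 1/2 * \<alpha>\<^sup>2 * \<tau> * (d \<bullet> (H *v d))
      + 1/2 * \<alpha>\<^sup>2 * (\<Sum>i\<in>UNIV. \<bar>d \<bullet> (hessian (\<lambda>z. c z $ i) x *v d)\<bar>) + e"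

text \<open>\<open>\<alpha>\<close> is the first member of \<open>1, \<nu>, \<nu>\<^sup>2, \<dots>\<close> that satisfies \<open>P\<close>; in particular the
  backtracking loop terminates.\<close>

definition backtracked :: "real \<Rightarrow> (real \<Rightarrow> bool) \<Rightarrow> real \<Rightarrow> bool"
  where "backtracked \<nu> P \<alpha> \<longleftrightarrow> (\<exists>j::nat. \<alpha> = \<nu> ^ j \<and> P (\<nu> ^ j) \<and> (\<forall>i<j. \<not> P (\<nu> ^ i)))"

definition tau_trial :: "real \<Rightarrow> real \<Rightarrow> real \<Rightarrow> ereal"
  where "tau_trial \<sigma> q v = (if q \<le> 0 then \<infinity> else ereal ((1 - \<sigma>) * v / q))"

definition tau_update :: "real \<Rightarrow> real \<Rightarrow> ereal \<Rightarrow> real"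
  where "tau_update \<epsilon> \<tau>prev \<tau>trial =
    (if ereal \<tau>prev \<le> \<tau>trial then \<tau>prev else (1 - \<epsilon>) * real_of_ereal \<tau>trial)"

definition unique_solution :: "real^'a^'b \<Rightarrow> real^'b \<Rightarrow> real^'a \<Rightarrow> bool"
  where "unique_solution A b s \<longleftrightarrow> A *v s = b \<and> (\<forall>s'. A *v s' = b \<longrightarrow> s' = s)"

end

theory Submission
  imports Defs
begin

text \<open>
  A sample size is an integer between \<open>1\<close> and \<open>N\<close>. The sample fractions of functions and gradients
  have summable defects, and the Hessian sample sizes converge to \<open>N\<close>; hence all samples are full
  from some iteration on (\<open>full_sample_eventually\<close>). From there on the method is the deterministic line search
  SQP method, and its tail decides both convergence and rate.

  \<^emph>\<open>Convergence.\<close> The inverse KKT matrices are bounded, so directions and updated multipliers are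
  bounded (\<open>kkt_step_bounded\<close>), and the curvature condition gives \<open>q\<^sub>k = O(norm (c\<^sub>k))\<close>
  (\<open>kkt_quotient_bound\<close>), which keeps the merit parameter away from zero. The model reduction then
  dominates \<open>norm (d\<^sub>k)\<^sup>2\<close>, backtracking accepts steps bounded below, and the merit function plus a
  multiple of \<open>\<gamma>\<^sub>k\<^sup>2\<close> decreases (\<open>potential_decrease\<close>); therefore \<open>d\<^sub>k\<close> tends to zero
  (\<open>step_tendsto_zero\<close>). The new multiplier cancels the old gradient of the Lagrangian up to
  \<open>O(norm (d\<^sub>k))\<close>, so the KKT residual tends to zero as well, and the growth condition yields
  convergence of the primal-dual iterates (\<open>iterates_converge\<close>).

  \<^emph>\<open>Rate.\<close> A full step is a Newton step for the KKT equations. As these are affine in the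
  multiplier, its error is \<open>o(norm (x\<^sub>k - x\<^sup>*))\<close> (\<open>full_step_error\<close>). It remains to see that full
  steps are eventually always taken. Short directions pass condition (B) with the unit step, so a
  full step is certain whenever \<open>norm (d\<^sub>k) \<le> \<gamma>\<^sub>k\<close> (\<open>unit_step_below_threshold\<close>). This inequality
  holds at some late iteration, because \<open>\<gamma>\<close> does not change while it fails. After that it persists:
  \<open>\<gamma>\<close> shrinks at most by the factor \<open>\<nu>\<^sub>\<gamma>\<close> per iteration, while a full step shrinks the direction at
  least by this factor. For the latter it is essential that the Newton error is measured by the primal
  error, which is comparable with \<open>norm (d\<^sub>k)\<close>; the primal-dual error is not, since a wrong
  multiplier can be corrected without any primal motion.
\<close>

section \<open>Spectral norms and block vectors\<close>

lemma norm_mult_vec_le_spectral: "norm (A *v v) \<le> spectral_norm A * norm v"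
  unfolding spectral_norm_def by (rule onorm[OF matrix_vector_mul_bounded_linear])

lemma spectral_norm_nonneg: "0 \<le> spectral_norm A"
  unfolding spectral_norm_def by (rule onorm_pos_le[OF matrix_vector_mul_bounded_linear])

lemma spectral_norm_le_norm: "spectral_norm A \<le> norm A"
  unfolding spectral_norm_def
proof (rule onorm_le)
  fix v :: "real^'a"
  have "norm (A *v v) = L2_set (\<lambda>i. A $ i \<bullet> v) UNIV"
    by (simp add: norm_vec_def matrix_vector_mul_component L2_set_def)
  also have "\<dots> \<le> L2_set (\<lambda>i. norm (A $ i) * norm v) UNIV"
    by (simp add: L2_set_def sum_mono Cauchy_Schwarz_ineq2 abs_le_square_iff[symmetric] power_mult_distrib[symmetric])
  also have "\<dots> = norm A * norm v"
    by (subst L2_set_left_distrib[symmetric]) (simp_all add: norm_vec_def)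
  finally show "norm (A *v v) \<le> norm A * norm v" .
qed

text \<open>Rows of a Jacobian are gradients, so this bound turns Lipschitz continuity of a Jacobian into
  Lipschitz continuity of the component gradients.\<close>

lemma norm_row_le_spectral: "norm (A $ j) \<le> spectral_norm A"
proof (cases "A $ j = 0")
  case True
  then show ?thesis by (simp add: spectral_norm_nonneg)
next
  case False
  have "norm (A $ j) * norm (A $ j) = (A *v (A $ j)) $ j"
    by (simp add: matrix_vector_mul_component dot_square_norm power2_eq_square)
  also have "\<dots> \<le> norm (A *v (A $ j))"
    using component_le_norm_cart[of "A *v (A $ j)" j] by simp
  also have "\<dots> \<le> spectral_norm A * norm (A $ j)"
    by (rule norm_mult_vec_le_spectral)
  finally show ?thesis using False by simp
qed

lemma norm_transpose_mult_vec_le: "norm (transpose A *v v) \<le> spectral_norm A * norm v"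
proof (cases "transpose A *v v = 0")
  case True
  then show ?thesis by (simp add: spectral_norm_nonneg)
next
  case False
  have "norm (transpose A *v v) * norm (transpose A *v v) = (transpose A *v v) \<bullet> (transpose A *v v)"
    by (simp add: dot_square_norm power2_eq_square)
  also have "\<dots> = v \<bullet> (A *v (transpose A *v v))"
    by (simp add: transpose_matrix_vector dot_lmul_matrix)
  also have "\<dots> \<le> norm v * (spectral_norm A * norm (transpose A *v v))"
    by (rule order_trans[OF norm_cauchy_schwarz])
       (simp add: mult_left_mono norm_mult_vec_le_spectral)
  finally have "norm (transpose A *v v) * norm (transpose A *v v)
      \<le> (spectral_norm A * norm v) * norm (transpose A *v v)"
    by (simp add: mult_ac)
  then show ?thesis using False by simp
qed

lemma spectral_lipschitz_onD:
  "\<lbrakk>spectral_lipschitz_on L S A; x \<in> S; z \<in> S\<rbrakk> \<Longrightarrow> spectral_norm (A x - A z) \<le> L * norm (x - z)"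
  by (simp add: spectral_lipschitz_on_def)

lemma norm_le_norm1: "norm v \<le> norm1 v"
  unfolding norm1_def by (rule norm_le_l1_cart)

lemma norm1_nonneg: "0 \<le> norm1 v"
  by (simp add: norm1_def sum_nonneg)

lemma norm1_le_sum: "(\<And>i. \<bar>v $ i\<bar> \<le> b i) \<Longrightarrow> norm1 v \<le> (\<Sum>i\<in>UNIV. b i)"
  unfolding norm1_def by (rule sum_mono) simp

lemma inner_stack: "stack a b \<bullet> stack a' b' = a \<bullet> a' + b \<bullet> b'"
proof -
  have "(\<Sum>i\<in>UNIV. stack a b $ i * stack a' b' $ i)
      = (\<Sum>i\<in>UNIV. a $ i * a' $ i) + (\<Sum>i\<in>UNIV. b $ i * b' $ i)"
    by (subst UNIV_Plus_UNIV[symmetric], subst sum.Plus) (simp_all add: stack_def)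
  then show ?thesis by (simp add: inner_vec_def)
qed

lemma norm_stack_sq: "(norm (stack a b))\<^sup>2 = (norm a)\<^sup>2 + (norm b)\<^sup>2"
  by (simp add: power2_norm_eq_inner inner_stack)

lemma norm_le_stack: "norm a \<le> norm (stack a b)" "norm b \<le> norm (stack a b)"
  by (rule power2_le_imp_le; simp add: norm_stack_sq)+

lemma norm_stack_le: "norm (stack a b) \<le> norm a + norm b"
  by (rule power2_le_imp_le) (simp_all add: norm_stack_sq power2_sum)

lemma stack_arith:
  "stack a b + stack a' b' = stack (a + a') (b + b')"
  "stack a b - stack a' b' = stack (a - a') (b - b')"
  "- stack a b = stack (- a) (- b)"
  by (simp_all add: stack_def vec_eq_iff split: sum.split)

lemma stack_eq_iff: "stack a b = stack a' b' \<longleftrightarrow> a = a' \<and> b = b'"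
proof
  assume *: "stack a b = stack a' b'"
  have "stack (a - a') (b - b') = 0"
    using * by (simp add: stack_arith(2)[symmetric])
  then have "(norm (a - a'))\<^sup>2 + (norm (b - b'))\<^sup>2 = 0"
    by (simp add: norm_stack_sq[symmetric])
  then show "a = a' \<and> b = b'" by (simp add: sum_power2_eq_zero_iff)
qed simp

lemma stack_primal_dual: "stack (primal z) (dual z) = z"
  by (simp add: stack_def primal_def dual_def vec_eq_iff split: sum.split)

lemma kkt_matrix_mult_stack:
  "kkt_matrix W J *v stack a b = stack (W *v a + transpose J *v b) (J *v a)"
proof -
  have "(kkt_matrix W J *v stack a b) $ i = stack (W *v a + transpose J *v b) (J *v a) $ i" for i
  proof -
    have "(kkt_matrix W J *v stack a b) $ i = (\<Sum>j\<in>UNIV <+> UNIV. kkt_matrix W J $ i $ j * stack a b $ j)"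
      by (simp add: matrix_vector_mult_def)
    also have "\<dots> = stack (W *v a + transpose J *v b) (J *v a) $ i"
      by (subst sum.Plus)
         (simp_all add: kkt_matrix_def stack_def matrix_vector_mult_def split: sum.split)
    finally show ?thesis .
  qed
  then show ?thesis by (simp add: vec_eq_iff)
qed

lemma invertible_lower_bound:
  assumes "invertible A" "spectral_norm (matrix_inv A) \<le> C"
  shows "norm z \<le> C * norm (A *v z)"
proof -
  have "matrix_inv A ** A = mat 1"
    using someI_ex[OF assms(1)[unfolded invertible_def]] by (simp add: matrix_inv_def)
  then have "z = matrix_inv A *v (A *v z)"
    by (simp add: matrix_vector_mul_assoc)
  then have "norm z \<le> spectral_norm (matrix_inv A) * norm (A *v z)"
    by (metis norm_mult_vec_le_spectral)
  also have "\<dots> \<le> C * norm (A *v z)"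
    by (rule mult_right_mono[OF assms(2)]) simp
  finally show ?thesis .
qed

section \<open>Gradients and Hessians\<close>

lemma gradient_eqI:
  assumes "GDERIV f x :> D" shows "gradient f x = D"
  unfolding gradient_def
proof (rule the_equality)
  show "GDERIV f x :> D" by (rule assms)
next
  fix D' assume "GDERIV f x :> D'"
  then have "(\<lambda>h. h \<bullet> D') = (\<lambda>h. h \<bullet> D)"
    using assms unfolding gderiv_def by (rule has_derivative_unique)
  then show "D' = D" by (metis vector_eq_ldot)
qed

lemma has_derivative_gradient:
  fixes f :: "real^'a \<Rightarrow> real"
  assumes "f differentiable (at x)"
  shows "(f has_derivative (\<lambda>h. h \<bullet> gradient f x)) (at x)"
proof -
  obtain f' where f': "(f has_derivative f') (at x)"
    using assms by (auto simp: differentiable_def)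
  have "f' h = h \<bullet> adjoint f' 1" for h
    using adjoint_works[OF has_derivative_linear[OF f'], of h 1] by simp
  then have "GDERIV f x :> adjoint f' 1"
    using f' unfolding gderiv_def by (metis (no_types, lifting) ext)
  with gradient_eqI[OF this] show ?thesis unfolding gderiv_def by simp
qed

lemma has_derivative_hessian:
  "gradient f differentiable (at x) \<Longrightarrow> (gradient f has_derivative (*v) (hessian f x)) (at x)"
  unfolding hessian_def using jacobian_works by blast

lemma hessian_eqI:
  assumes "(gradient f has_derivative (*v) A) (at x)"
  shows "hessian f x = A"
proof -
  have "gradient f differentiable (at x)" using assms by (auto simp: differentiable_def)
  from has_derivative_unique[OF assms has_derivative_hessian[OF this]]
  show ?thesis by (metis matrix_of_matrix_vector_mul)
qed

text \<open>The rows of a Jacobian are the component gradients, which is what links the matrices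
  \<open>J\<close> of the algorithm to the scalar constraint functions.\<close>

lemma jacobian_of_components:
  fixes c :: "real^'n \<Rightarrow> real^'m"
  assumes "\<And>j. (\<lambda>z. c z $ j) differentiable (at x)"
  shows "(c has_derivative (*v) (jacobian c (at x))) (at x)"
    and "jacobian c (at x) $ j = gradient (\<lambda>z. c z $ j) x"
proof -
  have "c differentiable (at x)"
    using assms by (subst differentiable_componentwise_within)
      (auto simp: Basis_vec_def inner_axis)
  then show D: "(c has_derivative (*v) (jacobian c (at x))) (at x)"
    using jacobian_works by blast
  have "((\<lambda>z. c z $ j) has_derivative (\<lambda>h. (jacobian c (at x) *v h) $ j)) (at x)"
    by (rule bounded_linear.has_derivative[OF bounded_linear_vec_nth D])
  then have "GDERIV (\<lambda>z. c z $ j) x :> jacobian c (at x) $ j"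
    by (simp add: gderiv_def matrix_vector_mul_component inner_commute)
  from gradient_eqI[OF this] show "jacobian c (at x) $ j = gradient (\<lambda>z. c z $ j) x" by simp
qed

lemma transpose_mult_vec_rows: "transpose A *v v = (\<Sum>j\<in>UNIV. v $ j *\<^sub>R A $ j)"
  by (simp add: vec_eq_iff matrix_vector_mult_def transpose_def mult.commute)

lemma average_full: "average {1..N} F = (1 / real N) *\<^sub>R (\<Sum>i\<in>{1..N}. F i)"
  by (simp add: average_def)

lemma gradient_average:
  fixes F :: "'i \<Rightarrow> real^'a \<Rightarrow> real"
  assumes "\<And>i. i \<in> S \<Longrightarrow> F i differentiable (at x)"
  shows "((\<lambda>z. a *\<^sub>R (\<Sum>i\<in>S. F i z)) has_derivative (\<lambda>h. h \<bullet> (a *\<^sub>R (\<Sum>i\<in>S. gradient (F i) x)))) (at x)"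
proof -
  have "((\<lambda>z. a *\<^sub>R (\<Sum>i\<in>S. F i z)) has_derivative (\<lambda>h. a *\<^sub>R (\<Sum>i\<in>S. h \<bullet> gradient (F i) x))) (at x)"
    by (intro has_derivative_scaleR_right has_derivative_sum has_derivative_gradient assms)
  then show ?thesis by (simp add: inner_sum_right)
qed

lemma matrix_sum_mult_vec:
  fixes A :: "'i \<Rightarrow> real^'n^'m"
  shows "(\<Sum>i\<in>S. A i) *v v = (\<Sum>i\<in>S. A i *v v)"
  by (induction S rule: infinite_finite_induct) (simp_all add: matrix_vector_mult_add_rdistrib)

lemma twice_cont_diff_sum:
  fixes F :: "'i \<Rightarrow> real^'a \<Rightarrow> real" and a :: real
  assumes "\<And>i. i \<in> S \<Longrightarrow> twice_cont_diff_on UNIV (F i)"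
  defines "f \<equiv> \<lambda>z. a *\<^sub>R (\<Sum>i\<in>S. F i z)"
  shows "twice_cont_diff_on UNIV f"
    and "gradient f z = a *\<^sub>R (\<Sum>i\<in>S. gradient (F i) z)"
    and "hessian f z = a *\<^sub>R (\<Sum>i\<in>S. hessian (F i) z)"
proof -
  have D: "\<And>i z. i \<in> S \<Longrightarrow> F i differentiable (at z)"
    and D2: "\<And>i z. i \<in> S \<Longrightarrow> gradient (F i) differentiable (at z)"
    and C: "\<And>i. i \<in> S \<Longrightarrow> continuous_on UNIV (hessian (F i))"
    using assms(1) by (auto simp: twice_cont_diff_on_def)
  have fd: "(f has_derivative (\<lambda>h. h \<bullet> (a *\<^sub>R (\<Sum>i\<in>S. gradient (F i) z)))) (at z)" for z
    unfolding f_def by (rule gradient_average[OF D])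
  then have g: "gradient f z = a *\<^sub>R (\<Sum>i\<in>S. gradient (F i) z)" for z
    by (intro gradient_eqI) (simp add: gderiv_def)
  then show "gradient f z = a *\<^sub>R (\<Sum>i\<in>S. gradient (F i) z)" .
  have "((\<lambda>z. a *\<^sub>R (\<Sum>i\<in>S. gradient (F i) z)) has_derivative
      (\<lambda>h. a *\<^sub>R (\<Sum>i\<in>S. hessian (F i) z *v h))) (at z)" for z
    by (intro has_derivative_scaleR_right has_derivative_sum has_derivative_hessian D2)
  moreover have "(\<lambda>h. a *\<^sub>R (\<Sum>i\<in>S. hessian (F i) z *v h)) = (*v) (a *\<^sub>R (\<Sum>i\<in>S. hessian (F i) z))" for z
    by (simp add: fun_eq_iff matrix_sum_mult_vec scaleR_matrix_vector_assoc[symmetric])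
  moreover have "gradient f = (\<lambda>z. a *\<^sub>R (\<Sum>i\<in>S. gradient (F i) z))" using g by auto
  ultimately have gd: "(gradient f has_derivative (*v) (a *\<^sub>R (\<Sum>i\<in>S. hessian (F i) z))) (at z)" for z
    by simp
  then have h: "hessian f z = a *\<^sub>R (\<Sum>i\<in>S. hessian (F i) z)" for z
    by (rule hessian_eqI)
  then show "hessian f z = a *\<^sub>R (\<Sum>i\<in>S. hessian (F i) z)" .
  have "hessian f = (\<lambda>z. a *\<^sub>R (\<Sum>i\<in>S. hessian (F i) z))" using h by auto
  then have "continuous_on UNIV (hessian f)"
    by (simp add: continuous_intros C)
  then show "twice_cont_diff_on UNIV f"
    using fd gd by (auto simp: twice_cont_diff_on_def differentiable_def)
qed

text \<open>The two Taylor estimates carry the constant \<open>L\<close> instead of \<open>L / 2\<close> and \<open>L / 6\<close>: only the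
  order in \<open>norm h\<close> matters below.\<close>

lemma linear_model_error:
  fixes f :: "real^'a \<Rightarrow> real"
  assumes f: "\<And>z. f differentiable (at z)"
    and X: "convex X" "x \<in> X" "x + h \<in> X"
    and lip: "\<And>z. z \<in> X \<Longrightarrow> norm (gradient f z - gradient f x) \<le> L * norm (z - x)"
    and L: "0 \<le> L"
  shows "\<bar>f (x + h) - f x - gradient f x \<bullet> h\<bar> \<le> L * (norm h)\<^sup>2"
proof -
  have seg: "closed_segment x (x + h) \<subseteq> X"
    using X by (intro closed_segment_subset) auto
  have "norm (f (x + h) - f x - (x + h - x) \<bullet> gradient f x) \<le> norm (x + h - x) * (L * norm h)"
  proof (rule differentiable_bound_linearization[where S = "closed_segment x (x + h)"
        and f' = "\<lambda>z h. h \<bullet> gradient f z" and ?x0.0 = x])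
    show "x + t *\<^sub>R (x + h - x) \<in> closed_segment x (x + h)" if "t \<in> {0..1}" for t
      using that by (auto simp: in_segment algebra_simps intro!: exI[of _ t])
    show "(f has_derivative (\<lambda>h. h \<bullet> gradient f z)) (at z within closed_segment x (x + h))" for z
      by (rule has_derivative_at_withinI[OF has_derivative_gradient[OF f]])
    show "onorm ((\<lambda>h. h \<bullet> gradient f z) - (\<lambda>h. h \<bullet> gradient f x)) \<le> L * norm h"
      if z: "z \<in> closed_segment x (x + h)" for z
    proof (rule onorm_le)
      fix v :: "real^'a"
      have "norm (((\<lambda>h. h \<bullet> gradient f z) - (\<lambda>h. h \<bullet> gradient f x)) v)
          = \<bar>v \<bullet> (gradient f z - gradient f x)\<bar>"
        by (simp add: inner_diff_right)
      also have "\<dots> \<le> norm v * norm (gradient f z - gradient f x)"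
        by (rule Cauchy_Schwarz_ineq2)
      also have "\<dots> \<le> norm v * (L * norm (z - x))"
        using z seg by (intro mult_left_mono lip) auto
      also have "\<dots> \<le> norm v * (L * norm h)"
        using segment_bound(1)[OF z] L by (intro mult_left_mono) auto
      finally show "norm (((\<lambda>h. h \<bullet> gradient f z) - (\<lambda>h. h \<bullet> gradient f x)) v) \<le> L * norm h * norm v"
        by (simp add: mult_ac)
    qed
  qed simp
  then show ?thesis by (simp add: inner_commute power2_eq_square mult_ac)
qed

lemma quadratic_model_error:
  fixes f :: "real^'a \<Rightarrow> real"
  assumes f: "twice_cont_diff_on UNIV f"
    and X: "convex X" "x \<in> X" "x + h \<in> X"
    and lip: "spectral_lipschitz_on L X (hessian f)"
  shows "\<bar>f (x + h) - f x - gradient f x \<bullet> h - 1/2 * (h \<bullet> (hessian f x *v h))\<bar> \<le> L * norm h ^ 3"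
proof -
  define diff :: "nat \<Rightarrow> real \<Rightarrow> real" where
    "diff m t = (if m = 0 then f (x + t *\<^sub>R h)
       else if m = 1 then gradient f (x + t *\<^sub>R h) \<bullet> h
       else h \<bullet> (hessian f (x + t *\<^sub>R h) *v h))" for m t
  have f1: "f differentiable (at z)" and f2: "gradient f differentiable (at z)" for z
    using f by (auto simp: twice_cont_diff_on_def)
  have "((\<lambda>t. f (x + t *\<^sub>R h)) has_derivative (\<lambda>s. (s *\<^sub>R h) \<bullet> gradient f (x + t *\<^sub>R h))) (at t)" for t
    by (rule has_derivative_compose[where g = f, OF _ has_derivative_gradient[OF f1]])
       (auto intro!: derivative_eq_intros)
  then have d0: "((\<lambda>t. f (x + t *\<^sub>R h)) has_real_derivative gradient f (x + t *\<^sub>R h) \<bullet> h) (at t)" for t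
    by (rule has_derivative_imp_has_field_derivative) (simp add: inner_commute)
  have "((\<lambda>t. gradient f (x + t *\<^sub>R h)) has_derivative (\<lambda>s. hessian f (x + t *\<^sub>R h) *v (s *\<^sub>R h))) (at t)" for t
    by (rule has_derivative_compose[where g = "gradient f", OF _ has_derivative_hessian[OF f2]])
       (auto intro!: derivative_eq_intros)
  then have "((\<lambda>t. gradient f (x + t *\<^sub>R h) \<bullet> h) has_derivative (\<lambda>s. (hessian f (x + t *\<^sub>R h) *v (s *\<^sub>R h)) \<bullet> h)) (at t)" for t
    by (rule bounded_linear.has_derivative[OF bounded_linear_inner_left])
  then have d1: "((\<lambda>t. gradient f (x + t *\<^sub>R h) \<bullet> h) has_real_derivative h \<bullet> (hessian f (x + t *\<^sub>R h) *v h)) (at t)" for t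
    by (rule has_derivative_imp_has_field_derivative) (simp add: inner_commute matrix_vector_mult_scaleR)
  have "\<exists>t. 0 < t \<and> t < 1 \<and> f (x + 1 *\<^sub>R h) = (\<Sum>m<2. (diff m 0 / fact m) * (1 - 0)^m) + (diff 2 t / fact 2) * (1 - 0)^2"
    by (rule Taylor_up[where a = 0]) (auto simp: diff_def less_2_cases_iff d0 d1)
  then obtain t where t: "0 < t" "t < 1"
    and eq: "f (x + h) = f x + gradient f x \<bullet> h + (h \<bullet> (hessian f (x + t *\<^sub>R h) *v h)) / 2"
    by (auto simp: diff_def numeral_2_eq_2)
  have z: "x + t *\<^sub>R h \<in> X"
  proof -
    have "(1 - t) *\<^sub>R x + t *\<^sub>R (x + h) \<in> X"
      using X t by (intro convexD) auto
    then show ?thesis by (simp add: algebra_simps)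
  qed
  have "\<bar>f (x + h) - f x - gradient f x \<bullet> h - 1/2 * (h \<bullet> (hessian f x *v h))\<bar>
      = 1/2 * \<bar>h \<bullet> ((hessian f (x + t *\<^sub>R h) - hessian f x) *v h)\<bar>"
    unfolding eq by (simp add: matrix_vector_mult_diff_rdistrib inner_diff_right abs_if field_simps)
  also have "\<dots> \<le> 1 * \<bar>h \<bullet> ((hessian f (x + t *\<^sub>R h) - hessian f x) *v h)\<bar>"
    by (rule mult_right_mono) auto
  also have "\<dots> \<le> norm h * (spectral_norm (hessian f (x + t *\<^sub>R h) - hessian f x) * norm h)"
    by (simp, rule order_trans[OF Cauchy_Schwarz_ineq2])
       (simp add: mult_left_mono norm_mult_vec_le_spectral)
  also have "\<dots> \<le> norm h * (L * norm h * norm h)"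
  proof (intro mult_left_mono mult_right_mono)
    have "spectral_norm (hessian f (x + t *\<^sub>R h) - hessian f x) \<le> L * norm (t *\<^sub>R h)"
      using spectral_lipschitz_onD[OF lip z X(2)] by simp
    also have "\<dots> \<le> L * norm h"
      using t lip by (intro mult_left_mono) (auto simp: spectral_lipschitz_on_def mult_left_le_one_le)
    finally show "spectral_norm (hessian f (x + t *\<^sub>R h) - hessian f x) \<le> L * norm h" .
  qed auto
  finally show ?thesis by (simp add: power3_eq_cube mult_ac)
qed

text \<open>The linear and the quadratic Taylor estimate differ by half the curvature along \<open>h\<close>, which is
  therefore bounded by Lipschitz constants alone. For the constraint functions these constants
  are the only available information on the size of the Hessian.\<close>

lemma curvature_bound:
  fixes f :: "real^'a \<Rightarrow> real"
  assumes f: "twice_cont_diff_on UNIV f"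
    and X: "convex X" "x \<in> X" "x + h \<in> X"
    and g: "\<And>z. z \<in> X \<Longrightarrow> norm (gradient f z - gradient f x) \<le> L * norm (z - x)" and L: "0 \<le> L"
    and H: "spectral_lipschitz_on L' X (hessian f)"
  shows "1/2 * \<bar>h \<bullet> (hessian f x *v h)\<bar> \<le> (L + L' * norm h) * (norm h)\<^sup>2"
proof -
  have "\<bar>f (x + h) - f x - gradient f x \<bullet> h\<bar> \<le> L * (norm h)\<^sup>2"
    using f by (intro linear_model_error[OF _ X g L]) (auto simp: twice_cont_diff_on_def)
  moreover have "\<bar>f (x + h) - f x - gradient f x \<bullet> h - 1/2 * (h \<bullet> (hessian f x *v h))\<bar>
      \<le> L' * norm h ^ 3"
    by (rule quadratic_model_error[OF f X H])
  moreover have "(L + L' * norm h) * (norm h)\<^sup>2 = L * (norm h)\<^sup>2 + L' * norm h ^ 3"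
    by (simp add: algebra_simps power2_eq_square power3_eq_cube)
  ultimately show ?thesis by (auto simp: abs_le_iff)
qed

text \<open>Linearizing at the moving point \<open>x k\<close> instead of at its limit costs only \<open>o\<close> of the
  distance, because the derivative is continuous at the limit.\<close>

lemma strict_linearization:
  fixes F :: "real^'a \<Rightarrow> real^'b"
  assumes F: "\<And>z. (F has_derivative (*v) (A z)) (at z)"
    and A: "isCont A p" and x: "x \<longlonglongrightarrow> p" and e: "0 < e"
  shows "\<forall>\<^sub>F k in sequentially. norm (A (x k) *v (x k - p) - (F (x k) - F p)) \<le> e * norm (x k - p)"
proof -
  obtain \<delta> where \<delta>: "0 < \<delta>" "\<And>z. dist z p < \<delta> \<Longrightarrow> dist (A z) (A p) < e / 2"
    using A e unfolding continuous_at_eps_delta by (metis half_gt_zero)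
  have "\<forall>\<^sub>F k in sequentially. dist (x k) p < \<delta>"
    using x \<delta>(1) by (rule tendstoD)
  then show ?thesis
  proof eventually_elim
    case (elim k)
    have "norm (F (x k) - F p - A (x k) *v (x k - p)) \<le> norm (x k - p) * e"
    proof (rule differentiable_bound_linearization[where S = "ball p \<delta>"
        and f' = "\<lambda>z. (*v) (A z)" and ?x0.0 = "x k"])
      show "p + t *\<^sub>R (x k - p) \<in> ball p \<delta>" if "t \<in> {0..1}" for t
      proof -
        have "dist p (p + t *\<^sub>R (x k - p)) = t * dist (x k) p"
          using that by (simp add: dist_norm)
        also have "\<dots> \<le> dist (x k) p" using that by (simp add: mult_left_le_one_le)
        finally show ?thesis using elim by simp
      qed
      show "(F has_derivative (*v) (A z)) (at z within ball p \<delta>)" for z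
        by (rule has_derivative_at_withinI[OF F])
      show "x k \<in> ball p \<delta>" using elim by (simp add: dist_commute)
      show "onorm ((*v) (A z) - (*v) (A (x k))) \<le> e" if "z \<in> ball p \<delta>" for z
      proof -
        have "(*v) (A z) - (*v) (A (x k)) = (*v) (A z - A (x k))"
          by (simp add: fun_eq_iff matrix_vector_mult_diff_rdistrib)
        then have "onorm ((*v) (A z) - (*v) (A (x k))) \<le> norm (A z - A (x k))"
          using spectral_norm_le_norm[of "A z - A (x k)"] by (simp add: spectral_norm_def)
        also have "\<dots> \<le> e"
          using \<delta>(2)[of z] \<delta>(2)[of "x k"] that elim dist_triangle_half_l[of "A z" "A p" e "A (x k)"]
          by (simp add: dist_commute dist_norm)
        finally show ?thesis .
      qed
    qed
    then show ?case by (simp add: norm_minus_commute mult.commute)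
  qed
qed

section \<open>The Newton-KKT step\<close>

context
  fixes W :: "real^'n^'n" and J :: "real^'n^'m" and \<Lambda> \<kappa> :: real
  assumes lower: "\<And>z. norm z \<le> \<Lambda> * norm (kkt_matrix W J *v z)"
    and upper: "\<And>z. norm (kkt_matrix W J *v z) \<le> \<kappa> * norm z"
begin

lemma kkt_block_bounds: "norm (W *v a) \<le> \<kappa> * norm a" "norm (J *v a) \<le> \<kappa> * norm a"
proof -
  have "norm (stack (W *v a) (J *v a)) \<le> \<kappa> * norm (stack a (0::real^'m))"
    using upper[of "stack a 0"] by (simp add: kkt_matrix_mult_stack)
  moreover have "norm (stack a (0::real^'m)) = norm a"
    by (rule power2_eq_imp_eq) (simp_all add: norm_stack_sq)
  ultimately show "norm (W *v a) \<le> \<kappa> * norm a" "norm (J *v a) \<le> \<kappa> * norm a"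
    using norm_le_stack(1)[of "W *v a" "J *v a"] norm_le_stack(2)[of "J *v a" "W *v a"] by simp_all
qed

lemma kkt_constants_nonneg: "0 \<le> \<Lambda>" "0 \<le> \<kappa>"
proof -
  let ?z = "1 :: real^('n+'m)"
  have "?z \<noteq> 0" by simp
  then have z: "0 < norm ?z" by simp
  have "0 < \<Lambda> * norm (kkt_matrix W J *v ?z)" using lower[of ?z] z by linarith
  then show "0 \<le> \<Lambda>" by (simp add: zero_less_mult_iff)
  have "0 \<le> \<kappa> * norm ?z" using upper[of ?z] norm_ge_zero order_trans by blast
  then show "0 \<le> \<kappa>" using z by (simp add: zero_le_mult_iff)
qed

context
  fixes g d :: "real^'n" and v \<delta> y :: "real^'m"
  assumes sys: "kkt_matrix W J *v stack d \<delta> = - stack (g + transpose J *v y) v"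
begin

lemma kkt_step_rows: "W *v d + transpose J *v (y + \<delta>) = - g" "J *v d = - v"
proof -
  have "stack (W *v d + transpose J *v \<delta>) (J *v d) = stack (- (g + transpose J *v y)) (- v)"
    using sys by (simp add: kkt_matrix_mult_stack stack_arith)
  then show "W *v d + transpose J *v (y + \<delta>) = - g" "J *v d = - v"
    by (auto simp: stack_eq_iff matrix_vector_right_distrib algebra_simps)
qed

text \<open>Passing from \<open>\<delta>\<close> to the new multiplier \<open>y + \<delta>\<close> removes \<open>y\<close> from the right-hand
  side, so that the new multiplier is bounded whatever the old one was.\<close>

lemma kkt_step_bounded:
  "norm d \<le> \<Lambda> * (norm g + norm v)" "norm (y + \<delta>) \<le> \<Lambda> * (norm g + norm v)"
proof -
  have "kkt_matrix W J *v stack d (y + \<delta>) = stack (- g) (- v)"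
    by (simp add: kkt_matrix_mult_stack kkt_step_rows del: transpose_matrix_vector)
  then have "norm (stack d (y + \<delta>)) \<le> \<Lambda> * norm (stack (- g) (- v))"
    using lower[of "stack d (y + \<delta>)"] by simp
  also have "\<dots> \<le> \<Lambda> * (norm g + norm v)"
    using norm_stack_le[of "- g" "- v"] by (intro mult_left_mono kkt_constants_nonneg) simp
  finally have *: "norm (stack d (y + \<delta>)) \<le> \<Lambda> * (norm g + norm v)" .
  show "norm d \<le> \<Lambda> * (norm g + norm v)" "norm (y + \<delta>) \<le> \<Lambda> * (norm g + norm v)"
    using * norm_le_stack(1)[of d "y + \<delta>"] norm_le_stack(2)[of "y + \<delta>" d] by linarith+
qed

text \<open>Write \<open>d\<close> as a null vector of \<open>J\<close> plus a vector of size \<open>O(norm v)\<close>. The curvature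
  condition makes the first part harmless, so negative curvature along \<open>d\<close> is itself
  \<open>O(norm v)\<close>; and \<open>W d + J\<^sup>T (y + \<delta>) = - g\<close> turns \<open>g \<bullet> d\<close> into the negative of this
  curvature plus \<open>(y + \<delta>) \<bullet> v\<close>.\<close>

lemma kkt_quotient_bound:
  assumes inv: "invertible (kkt_matrix W J)"
    and curv: "\<And>u. J *v u = 0 \<Longrightarrow> 0 \<le> u \<bullet> (W *v u)"
  shows "g \<bullet> d + max (d \<bullet> (W *v d)) 0
    \<le> (norm (y + \<delta>) + \<kappa> * \<Lambda> * (2 * norm d + \<Lambda> * norm v)) * norm v"
proof -
  note nn = kkt_constants_nonneg
  obtain B where "kkt_matrix W J ** B = mat 1"
    using inv by (auto simp: invertible_def)
  then have "kkt_matrix W J *v (B *v stack 0 (- v)) = stack 0 (- v)"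
    by (simp add: matrix_vector_mul_assoc)
  then obtain a l where al: "kkt_matrix W J *v stack a l = stack 0 (- v)"
    by (metis stack_primal_dual)
  have "norm (stack a l) \<le> \<Lambda> * norm (stack (0::real^'n) (- v))"
    using lower[of "stack a l"] al by simp
  also have "norm (stack (0::real^'n) (- v)) = norm v"
    by (rule power2_eq_imp_eq) (simp_all add: norm_stack_sq)
  finally have a: "norm a \<le> \<Lambda> * norm v"
    using norm_le_stack(1)[of a l] by simp
  have "J *v a = - v"
    using al by (simp add: kkt_matrix_mult_stack stack_eq_iff)
  then have "J *v (d - a) = 0"
    by (simp add: matrix_vector_mult_diff_distrib kkt_step_rows)
  then have c0: "0 \<le> (d - a) \<bullet> (W *v (d - a))" by (rule curv)
  have "d \<bullet> (W *v d) = (d - a) \<bullet> (W *v (d - a)) + (d - a) \<bullet> (W *v a) + a \<bullet> (W *v d)"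
    by (simp add: matrix_vector_mult_diff_distrib algebra_simps)
  moreover have "\<bar>(d - a) \<bullet> (W *v a)\<bar> \<le> (norm d + norm a) * (\<kappa> * norm a)"
    using norm_triangle_ineq4[of d a] kkt_block_bounds(1)[of a]
    by (intro order_trans[OF Cauchy_Schwarz_ineq2] mult_mono) auto
  moreover have "\<bar>a \<bullet> (W *v d)\<bar> \<le> norm a * (\<kappa> * norm d)"
    using kkt_block_bounds(1)[of d]
    by (intro order_trans[OF Cauchy_Schwarz_ineq2] mult_mono) auto
  ultimately have "- (d \<bullet> (W *v d)) \<le> \<kappa> * norm a * (2 * norm d + norm a)"
    using c0 by (simp add: algebra_simps)
  also have "\<dots> \<le> \<kappa> * (\<Lambda> * norm v) * (2 * norm d + \<Lambda> * norm v)"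
    using a nn by (intro mult_mono mult_left_mono add_left_mono) auto
  finally have neg: "- (d \<bullet> (W *v d)) \<le> \<kappa> * (\<Lambda> * norm v) * (2 * norm d + \<Lambda> * norm v)" .
  have pos: "0 \<le> \<kappa> * (\<Lambda> * norm v) * (2 * norm d + \<Lambda> * norm v)"
    using nn by simp
  have "g = - (W *v d) - transpose J *v (y + \<delta>)"
    using kkt_step_rows(1) by (metis add_diff_cancel_left' minus_diff_commute uminus_add_conv_diff minus_minus diff_minus_eq_add)
  then have "g \<bullet> d = (- (W *v d) - transpose J *v (y + \<delta>)) \<bullet> d" by simp
  also have "\<dots> = - (d \<bullet> (W *v d)) - (transpose J *v (y + \<delta>)) \<bullet> d"
    by (simp only: inner_diff_left inner_minus_left inner_commute[of d])
  also have "(transpose J *v (y + \<delta>)) \<bullet> d = (y + \<delta>) \<bullet> (J *v d)"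
    by (simp add: transpose_matrix_vector dot_lmul_matrix)
  also have "\<dots> = - ((y + \<delta>) \<bullet> v)" by (simp add: kkt_step_rows)
  finally have "g \<bullet> d = - (d \<bullet> (W *v d)) + (y + \<delta>) \<bullet> v" by simp
  moreover have "(y + \<delta>) \<bullet> v \<le> norm (y + \<delta>) * norm v" by (rule norm_cauchy_schwarz)
  moreover have "(norm (y + \<delta>) + \<kappa> * \<Lambda> * (2 * norm d + \<Lambda> * norm v)) * norm v
      = norm (y + \<delta>) * norm v + \<kappa> * (\<Lambda> * norm v) * (2 * norm d + \<Lambda> * norm v)"
    by (simp add: algebra_simps)
  ultimately show ?thesis using neg pos by (simp add: max_def)
qed

end

end

section \<open>Merit parameter and backtracking\<close>

text \<open>A decrease of the merit parameter always ends at \<open>(1 - \<epsilon>) (1 - \<sigma>) v / q\<close>, so a bound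
  \<open>q \<le> C v\<close> keeps the parameter away from zero through any number of updates. For \<open>v = 0\<close> the
  same bound says that no update happens.\<close>

lemma tau_update_bounds:
  assumes \<tau>: "0 < \<tau>" and \<epsilon>: "0 < \<epsilon>" "\<epsilon> < 1" and \<sigma>: "0 < \<sigma>" "\<sigma> < 1"
    and C: "0 < C" and v: "0 \<le> v" and q: "q \<le> C * v"
  defines "\<tau>' \<equiv> tau_update \<epsilon> \<tau> (tau_trial \<sigma> q v)"
  shows "min \<tau> ((1 - \<epsilon>) * (1 - \<sigma>) / C) \<le> \<tau>'" "\<tau>' \<le> \<tau>" "0 < \<tau>'"
proof -
  have "min \<tau> ((1 - \<epsilon>) * (1 - \<sigma>) / C) \<le> \<tau>' \<and> \<tau>' \<le> \<tau>"
  proof (cases "q \<le> 0 \<or> \<tau> \<le> (1 - \<sigma>) * v / q")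
    case True
    then show ?thesis by (auto simp: \<tau>'_def tau_update_def tau_trial_def)
  next
    case False
    then have q0: "0 < q" and lt: "(1 - \<sigma>) * v / q < \<tau>" by auto
    have eq: "\<tau>' = (1 - \<epsilon>) * ((1 - \<sigma>) * v / q)"
      using q0 lt by (simp add: \<tau>'_def tau_update_def tau_trial_def)
    have "(1 - \<sigma>) / C \<le> (1 - \<sigma>) * v / q"
    proof -
      have "(1 - \<sigma>) * q \<le> (1 - \<sigma>) * (C * v)"
        using q \<sigma> by (intro mult_left_mono) auto
      then show ?thesis using q0 C by (simp add: divide_simps mult_ac)
    qed
    then have "(1 - \<epsilon>) * ((1 - \<sigma>) / C) \<le> \<tau>'"
      unfolding eq using \<epsilon> by (intro mult_left_mono) auto
    moreover have "0 \<le> (1 - \<sigma>) * v / q" using q0 v \<sigma> by simp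
    then have "\<tau>' \<le> (1 - \<sigma>) * v / q"
      unfolding eq using \<epsilon> by (intro mult_left_le_one_le) auto
    ultimately show ?thesis using lt by (simp add: min_le_iff_disj)
  qed
  moreover have "0 < min \<tau> ((1 - \<epsilon>) * (1 - \<sigma>) / C)"
    using \<tau> \<epsilon> \<sigma> C by simp
  ultimately show "min \<tau> ((1 - \<epsilon>) * (1 - \<sigma>) / C) \<le> \<tau>'" "\<tau>' \<le> \<tau>" "0 < \<tau>'"
    by linarith+
qed

lemma backtracked_accepted: "backtracked \<nu> P \<alpha> \<Longrightarrow> P \<alpha>"
  by (auto simp: backtracked_def)

lemma backtracked_full: "\<lbrakk>backtracked \<nu> P \<alpha>; P 1\<rbrakk> \<Longrightarrow> \<alpha> = 1"
  unfolding backtracked_def by (metis gr0I power_0)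

text \<open>The step tried just before the accepted one was rejected, hence longer than \<open>a0\<close>.\<close>

lemma backtracked_bounds:
  assumes bt: "backtracked \<nu> P \<alpha>" and \<nu>: "0 < \<nu>" "\<nu> < 1"
    and ok: "\<And>a. \<lbrakk>0 < a; a \<le> 1; a \<le> a0\<rbrakk> \<Longrightarrow> P a"
  shows "min 1 (\<nu> * a0) \<le> \<alpha>" "\<alpha> \<le> 1" "0 < \<alpha>"
proof -
  obtain j where j: "\<alpha> = \<nu> ^ j" "\<And>i. i < j \<Longrightarrow> \<not> P (\<nu> ^ i)"
    using bt by (auto simp: backtracked_def)
  show "\<alpha> \<le> 1" "0 < \<alpha>" using j(1) \<nu> by (auto intro: power_le_one)
  show "min 1 (\<nu> * a0) \<le> \<alpha>"
  proof (cases j)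
    case 0
    then show ?thesis using j by simp
  next
    case (Suc i)
    then have "\<not> P (\<nu> ^ i)" using j(2) by simp
    then have "a0 < \<nu> ^ i" using ok[of "\<nu> ^ i"] \<nu> by (force intro: power_le_one)
    then show ?thesis using Suc j(1) \<nu> by (simp add: min_le_iff_disj)
  qed
qed

section \<open>Sequences\<close>

lemma decreasing_potential_tendsto_zero:
  fixes \<Phi> r :: "nat \<Rightarrow> real"
  assumes "\<And>k. 0 \<le> \<Phi> k" "\<And>k. 0 \<le> r k" "\<And>k. \<Phi> (Suc k) \<le> \<Phi> k - r k"
  shows "r \<longlonglongrightarrow> 0"
proof -
  have "decseq \<Phi>"
    using assms(2,3) by (intro decseq_SucI) (smt (verit))
  then obtain l where l: "\<Phi> \<longlonglongrightarrow> l"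
    using decseq_convergent[of \<Phi> 0] assms(1) by metis
  have "(\<lambda>k. \<Phi> k - \<Phi> (Suc k)) \<longlonglongrightarrow> l - l"
    by (intro tendsto_diff l LIMSEQ_Suc)
  then have "(\<lambda>k. \<Phi> k - \<Phi> (Suc k)) \<longlonglongrightarrow> 0" by simp
  moreover have "\<forall>\<^sub>F k in sequentially. norm (r k) \<le> \<Phi> k - \<Phi> (Suc k)"
    using assms(2,3) by (intro always_eventually allI) (smt (verit) real_norm_def)
  ultimately show ?thesis by (rule Lim_null_comparison[rotated])
qed

text \<open>A majorant of an error sequence must be positive even if the errors vanish; adding a
  sequence that is itself superlinear and positive repairs this without harming the rate.\<close>

lemma superlinear_majorant:
  fixes u :: "nat \<Rightarrow> real"
  assumes u: "\<And>k. 0 \<le> u k"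
    and rate: "\<And>e. 0 < e \<Longrightarrow> \<forall>\<^sub>F k in sequentially. u (Suc k) \<le> e * u k"
  shows "\<exists>\<xi>. (\<forall>k. 0 < \<xi> k) \<and> (\<forall>k. u k \<le> \<xi> k) \<and> (\<lambda>k. \<xi> (Suc k) / \<xi> k) \<longlonglongrightarrow> 0"
proof (intro exI conjI allI)
  define \<xi> where "\<xi> k = u k + 1 / fact k" for k
  have pos: "0 < \<xi> k" for k
    using u[of k] by (simp add: \<xi>_def add_nonneg_pos)
  then show "0 < \<xi> k" for k .
  show "u k \<le> \<xi> k" for k by (simp add: \<xi>_def)
  show "(\<lambda>k. \<xi> (Suc k) / \<xi> k) \<longlonglongrightarrow> 0"
  proof (rule tendstoI)
    fix e :: real assume e: "0 < e"
    have "\<forall>\<^sub>F k in sequentially. u (Suc k) \<le> (e / 2) * u k" using e by (intro rate) simp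
    moreover have "\<forall>\<^sub>F k in sequentially. 1 / real (Suc k) < e / 2"
      using order_tendstoD(2)[OF LIMSEQ_inverse_real_of_nat, of "e / 2"] e
      by (simp add: inverse_eq_divide)
    ultimately show "\<forall>\<^sub>F k in sequentially. dist (\<xi> (Suc k) / \<xi> k) 0 < e"
    proof eventually_elim
      case (elim k)
      have "1 / fact (Suc k) = (1 / real (Suc k)) * (1 / fact k)" by simp
      also have "\<dots> \<le> (e / 2) * (1 / fact k)" using elim(2) by (intro mult_right_mono) auto
      finally have "\<xi> (Suc k) \<le> (e / 2) * \<xi> k"
        using elim(1) unfolding \<xi>_def by (simp only: distrib_left)
      then have "\<xi> (Suc k) / \<xi> k \<le> e / 2" using pos[of k] by (simp add: divide_simps mult_ac)
      moreover have "dist (\<xi> (Suc k) / \<xi> k) 0 = \<xi> (Suc k) / \<xi> k"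
        using pos[of k] pos[of "Suc k"] by (simp add: less_imp_le)
      ultimately show ?case using e by linarith
    qed
  qed
qed

text \<open>Cardinalities are integers, so full samples are reached in the limit only by being
  reached.\<close>

lemma full_sample_eventually:
  fixes S :: "nat \<Rightarrow> nat set"
  assumes S: "\<And>k. S k \<subseteq> {1..N}" and lim: "(\<lambda>k. real (card (S k))) \<longlonglongrightarrow> real N"
  shows "\<forall>\<^sub>F k in sequentially. S k = {1..N}"
proof -
  have "\<forall>\<^sub>F k in sequentially. dist (real (card (S k))) (real N) < 1"
    by (rule tendstoD[OF lim]) simp
  then show ?thesis
  proof eventually_elim
    case (elim k)
    then have "card (S k) = N" by (simp add: dist_real_def)
    then show ?case using S[of k] by (intro card_subset_eq) auto
  qed
qed

section \<open>Global convergence with exact samples\<close>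

text \<open>The iteration with all three samples full: the average functions are \<open>f\<close>, its gradient and
  its Hessian, and the relaxation \<open>\<epsilon>\<^sub>A\<close> of the conditions (A) and (B), which vanishes with the
  sampling errors, is \<open>0\<close>. The index \<open>0\<close> stands for the first iteration from which this holds, so
  the merit parameter and the threshold start from whatever positive values they have reached.\<close>

locale exact_sqp =
  fixes f :: "real^'n \<Rightarrow> real" and c :: "real^'n \<Rightarrow> real^'m" and X :: "(real^'n) set"
    and J :: "real^'n \<Rightarrow> real^'n^'m" and W :: "nat \<Rightarrow> real^'n^'n"
    and x d :: "nat \<Rightarrow> real^'n" and y \<delta> :: "nat \<Rightarrow> real^'m" and \<tau> \<gamma> \<alpha> :: "nat \<Rightarrow> real"
    and \<kappa>\<^sub>f \<kappa>\<^sub>g \<kappa>\<^sub>c L\<^sub>1 L\<^sub>2 \<Gamma>\<^sub>1 \<Gamma>\<^sub>2 \<Lambda> \<kappa>\<^sub>M \<nu>\<^sub>\<alpha> \<nu>\<^sub>\<gamma> \<epsilon>\<^sub>\<tau> \<sigma> \<eta> \<kappa>\<^sub>l :: real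
  assumes J_def: "J = (\<lambda>z. jacobian c (at z))"
    and W_def: "\<And>k. W k = hessian f (x k) + (\<Sum>i\<in>UNIV. (y k $ i) *\<^sub>R hessian (\<lambda>z. c z $ i) (x k))"
    and f_C2: "twice_cont_diff_on UNIV f" and c_C2: "\<And>j. twice_cont_diff_on UNIV (\<lambda>z. c z $ j)"
    and X: "convex X" "\<And>k. x k \<in> X" "\<And>k. x k + d k \<in> X"
    and f_bound: "\<And>z. z \<in> X \<Longrightarrow> \<bar>f z\<bar> \<le> \<kappa>\<^sub>f"
    and g_bound: "\<And>z. z \<in> X \<Longrightarrow> norm (gradient f z) \<le> \<kappa>\<^sub>g"
    and c_bound: "\<And>z. z \<in> X \<Longrightarrow> norm (c z) \<le> \<kappa>\<^sub>c"
    and g_lip: "L\<^sub>1-lipschitz_on X (gradient f)" and H_lip: "spectral_lipschitz_on L\<^sub>2 X (hessian f)"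
    and J_lip: "spectral_lipschitz_on \<Gamma>\<^sub>1 X J"
    and Hc_lip: "\<And>j. spectral_lipschitz_on \<Gamma>\<^sub>2 X (hessian (\<lambda>z. c z $ j))"
    and kkt_invertible: "\<And>k. invertible (kkt_matrix (W k) (J (x k)))"
    and kkt_lower: "\<And>k z. norm z \<le> \<Lambda> * norm (kkt_matrix (W k) (J (x k)) *v z)"
    and kkt_upper: "\<And>k z. norm (kkt_matrix (W k) (J (x k)) *v z) \<le> \<kappa>\<^sub>M * norm z"
    and curvature: "\<And>k u. J (x k) *v u = 0 \<Longrightarrow> 0 \<le> u \<bullet> (W k *v u)"
    and params: "0 < \<tau> 0" "0 < \<gamma> 0" "0 < \<nu>\<^sub>\<alpha>" "\<nu>\<^sub>\<alpha> < 1" "0 < \<nu>\<^sub>\<gamma>" "\<nu>\<^sub>\<gamma> < 1" "0 < \<epsilon>\<^sub>\<tau>" "\<epsilon>\<^sub>\<tau> < 1"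
      "0 < \<sigma>" "\<sigma> < 1" "0 < \<eta>" "\<eta> < 1" "0 < \<kappa>\<^sub>l"
    and step: "\<And>k. kkt_matrix (W k) (J (x k)) *v stack (d k) (\<delta> k)
        = - stack (gradient f (x k) + transpose (J (x k)) *v y k) (c (x k))"
    and tau_step: "\<And>k. \<tau> (Suc k) = tau_update \<epsilon>\<^sub>\<tau> (\<tau> k) (tau_trial \<sigma>
        (gradient f (x (Suc k)) \<bullet> d (Suc k) + max (d (Suc k) \<bullet> (W (Suc k) *v d (Suc k))) 0)
        (norm1 (c (x (Suc k)))))"
    and line_search: "\<And>k.
        if norm (d k) > \<gamma> k
        then backtracked \<nu>\<^sub>\<alpha> (cond_A f c \<eta> (x k) (\<tau> k) (gradient f (x k)) (d k) 0) (\<alpha> k)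
             \<and> \<gamma> (Suc k) = \<gamma> k
        else if cond_A f c \<eta> (x k) (\<tau> k) (gradient f (x k)) (d k) 0 1
        then \<alpha> k = 1 \<and> \<gamma> (Suc k) = \<gamma> k
        else backtracked \<nu>\<^sub>\<alpha>
               (cond_B f c \<eta> (x k) (\<tau> k) (gradient f (x k)) (hessian f (x k)) (d k) 0) (\<alpha> k)
             \<and> \<gamma> (Suc k) = \<nu>\<^sub>\<gamma> * \<gamma> k"
    and x_Suc: "\<And>k. x (Suc k) = x k + \<alpha> k *\<^sub>R d k" and y_Suc: "\<And>k. y (Suc k) = y k + \<delta> k"
    and reduction: "\<And>k. \<kappa>\<^sub>l * \<tau> k * (norm (d k))\<^sup>2
        \<le> model_reduction c (x k) (\<tau> k) (gradient f (x k)) (d k)"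
begin

abbreviation "\<Delta>l k \<equiv> model_reduction c (x k) (\<tau> k) (gradient f (x k)) (d k)"

text \<open>A common bound for the directions and for the updated multipliers.\<close>

definition "D = \<Lambda> * (\<kappa>\<^sub>g + \<kappa>\<^sub>c)"

lemma constants_nonneg: "0 \<le> \<Lambda>" "0 \<le> \<kappa>\<^sub>M" "0 \<le> L\<^sub>1" "0 \<le> L\<^sub>2" "0 \<le> \<Gamma>\<^sub>1" "0 \<le> \<Gamma>\<^sub>2" "0 \<le> \<kappa>\<^sub>g" "0 \<le> \<kappa>\<^sub>c" "0 \<le> D"
proof -
  show "0 \<le> \<Lambda>" "0 \<le> \<kappa>\<^sub>M"
    by (rule kkt_constants_nonneg[OF kkt_lower kkt_upper])+
  show "0 \<le> L\<^sub>1" "0 \<le> L\<^sub>2" "0 \<le> \<Gamma>\<^sub>1" "0 \<le> \<Gamma>\<^sub>2"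
    using g_lip H_lip J_lip Hc_lip by (auto simp: lipschitz_on_def spectral_lipschitz_on_def)
  show "0 \<le> \<kappa>\<^sub>g" "0 \<le> \<kappa>\<^sub>c"
    using g_bound[OF X(2)[of 0]] c_bound[OF X(2)[of 0]] norm_ge_zero order_trans by blast+
  with \<open>0 \<le> \<Lambda>\<close> show "0 \<le> D" by (simp add: D_def)
qed

lemma differentiable:
  "f differentiable (at z)" "gradient f differentiable (at z)"
  "(\<lambda>z. c z $ j) differentiable (at z)" "gradient (\<lambda>z. c z $ j) differentiable (at z)"
  using f_C2 c_C2 by (auto simp: twice_cont_diff_on_def)

lemma J_row: "J z $ j = gradient (\<lambda>z. c z $ j) z"
  unfolding J_def by (rule jacobian_of_components) (rule differentiable)

lemma c_deriv: "(c has_derivative (*v) (J z)) (at z)"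
  unfolding J_def by (rule jacobian_of_components) (rule differentiable)

lemma gradient_lipschitz:
  assumes "z \<in> X" "u \<in> X"
  shows "norm (gradient f z - gradient f u) \<le> L\<^sub>1 * norm (z - u)"
    and "norm (gradient (\<lambda>z. c z $ j) z - gradient (\<lambda>z. c z $ j) u) \<le> \<Gamma>\<^sub>1 * norm (z - u)"
proof -
  show "norm (gradient f z - gradient f u) \<le> L\<^sub>1 * norm (z - u)"
    using lipschitz_onD[OF g_lip assms] by (simp add: dist_norm)
  have "norm (gradient (\<lambda>z. c z $ j) z - gradient (\<lambda>z. c z $ j) u) \<le> spectral_norm (J z - J u)"
    using norm_row_le_spectral[of "J z - J u" j] by (simp add: J_row)
  also have "\<dots> \<le> \<Gamma>\<^sub>1 * norm (z - u)" by (rule spectral_lipschitz_onD[OF J_lip assms])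
  finally show "norm (gradient (\<lambda>z. c z $ j) z - gradient (\<lambda>z. c z $ j) u) \<le> \<Gamma>\<^sub>1 * norm (z - u)" .
qed

lemma step_bounded: "norm (d k) \<le> D" "norm (y k + \<delta> k) \<le> D"
proof -
  have "\<Lambda> * (norm (gradient f (x k)) + norm (c (x k))) \<le> D"
    unfolding D_def using g_bound[OF X(2)] c_bound[OF X(2)] constants_nonneg
    by (intro mult_left_mono add_mono) auto
  then show "norm (d k) \<le> D" "norm (y k + \<delta> k) \<le> D"
    using kkt_step_bounded[OF kkt_lower kkt_upper step, of k] by linarith+
qed

lemma linearized_constraint: "gradient (\<lambda>z. c z $ j) (x k) \<bullet> d k = - c (x k) $ j"
proof -
  have "J (x k) *v d k = - c (x k)" by (rule kkt_step_rows[OF kkt_lower kkt_upper step])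
  then have "(J (x k) *v d k) $ j = - c (x k) $ j" by simp
  then show ?thesis by (simp add: matrix_vector_mul_component J_row)
qed

lemma tau_mono: "0 < \<tau> k" "\<tau> (Suc k) \<le> \<tau> k" "\<tau> k \<le> \<tau> 0"
  and tau_bounded_below: "\<exists>t>0. \<forall>k. t \<le> \<tau> k"
proof -
  define C where "C = D + \<kappa>\<^sub>M * \<Lambda> * (2 * D + \<Lambda> * \<kappa>\<^sub>c) + 1"
  note nn = constants_nonneg
  have C: "0 < C" unfolding C_def using nn by (simp add: add_nonneg_pos)
  have q: "gradient f (x k) \<bullet> d k + max (d k \<bullet> (W k *v d k)) 0 \<le> C * norm1 (c (x k))" for k
  proof -
    have "gradient f (x k) \<bullet> d k + max (d k \<bullet> (W k *v d k)) 0
      \<le> (norm (y k + \<delta> k) + \<kappa>\<^sub>M * \<Lambda> * (2 * norm (d k) + \<Lambda> * norm (c (x k)))) * norm (c (x k))"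
      by (rule kkt_quotient_bound[OF kkt_lower kkt_upper step kkt_invertible curvature])
    also have "\<dots> \<le> (D + \<kappa>\<^sub>M * \<Lambda> * (2 * D + \<Lambda> * \<kappa>\<^sub>c)) * norm1 (c (x k))"
      using nn step_bounded[of k] c_bound[OF X(2)[of k]] norm_le_norm1[of "c (x k)"]
      by (intro mult_mono add_mono mult_left_mono) auto
    also have "\<dots> \<le> C * norm1 (c (x k))"
      unfolding C_def by (intro mult_right_mono norm1_nonneg) simp
    finally show ?thesis .
  qed
  define t where "t = (1 - \<epsilon>\<^sub>\<tau>) * (1 - \<sigma>) / C"
  have upd: "min (\<tau> k) t \<le> \<tau> (Suc k) \<and> \<tau> (Suc k) \<le> \<tau> k \<and> 0 < \<tau> (Suc k)" if "0 < \<tau> k" for k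
    unfolding t_def tau_step
    using tau_update_bounds[OF that params(7,8,9,10) C norm1_nonneg q] by simp
  show pos: "0 < \<tau> k" for k
    by (induction k) (use params(1) upd in auto)
  show dec: "\<tau> (Suc k) \<le> \<tau> k" for k using upd[OF pos] by simp
  show "\<tau> k \<le> \<tau> 0" for k
    by (induction k) (auto intro: order_trans[OF dec])
  have "min (\<tau> 0) t \<le> \<tau> k" for k
  proof (induction k)
    case (Suc k)
    then show ?case using upd[OF pos, of k] by linarith
  qed simp
  moreover have "0 < min (\<tau> 0) t" using params C by (simp add: t_def)
  ultimately show "\<exists>t>0. \<forall>k. t \<le> \<tau> k" by blast
qed

text \<open>The step satisfies the linearized constraints, so \<open>c\<close> shrinks by the factor \<open>1 - a\<close> up to
  second order. The merit function thus falls by \<open>a\<close> times the model reduction up to second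
  order, in the objective and in the constraints alike.\<close>

lemma merit_linear_model:
  assumes a: "0 \<le> a" "a \<le> 1"
  shows "merit f c (x k + a *\<^sub>R d k) (\<tau> k) \<le> merit f c (x k) (\<tau> k) - a * \<Delta>l k
     + (\<tau> 0 * L\<^sub>1 + real CARD('m) * \<Gamma>\<^sub>1) * (a * norm (d k))\<^sup>2"
proof -
  note nn = constants_nonneg
  have "(1 - a) *\<^sub>R x k + a *\<^sub>R (x k + d k) \<in> X"
    using X a by (intro convexD) auto
  then have in_X: "x k + a *\<^sub>R d k \<in> X" by (simp add: algebra_simps)
  have norm_eq: "norm (a *\<^sub>R d k) = a * norm (d k)" using a by simp
  define B where "B = (a * norm (d k))\<^sup>2"
  have B: "0 \<le> B" by (simp add: B_def)
  have "\<bar>f (x k + a *\<^sub>R d k) - f (x k) - gradient f (x k) \<bullet> (a *\<^sub>R d k)\<bar> \<le> L\<^sub>1 * (norm (a *\<^sub>R d k))\<^sup>2"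
    by (rule linear_model_error[OF differentiable(1) X(1,2) in_X gradient_lipschitz(1)[OF _ X(2)] nn(3)])
  then have fb: "f (x k + a *\<^sub>R d k) \<le> f (x k) + a * (gradient f (x k) \<bullet> d k) + L\<^sub>1 * B"
    unfolding norm_eq B_def[symmetric] by (simp add: abs_le_iff)
  have "\<tau> k * f (x k + a *\<^sub>R d k) \<le> \<tau> k * (f (x k) + a * (gradient f (x k) \<bullet> d k) + L\<^sub>1 * B)"
    using tau_mono(1)[of k] by (intro mult_left_mono fb) simp
  also have "\<dots> = \<tau> k * f (x k) + a * (\<tau> k * (gradient f (x k) \<bullet> d k)) + \<tau> k * (L\<^sub>1 * B)"
    by (simp add: algebra_simps)
  also have "\<tau> k * (L\<^sub>1 * B) \<le> \<tau> 0 * (L\<^sub>1 * B)"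
    using tau_mono(3)[of k] nn B by (intro mult_right_mono) auto
  finally have 1: "\<tau> k * f (x k + a *\<^sub>R d k)
      \<le> \<tau> k * f (x k) + a * (\<tau> k * (gradient f (x k) \<bullet> d k)) + \<tau> 0 * (L\<^sub>1 * B)" by simp
  have cb: "\<bar>c (x k + a *\<^sub>R d k) $ j\<bar> \<le> (1 - a) * \<bar>c (x k) $ j\<bar> + \<Gamma>\<^sub>1 * B" for j
  proof -
    have "\<bar>c (x k + a *\<^sub>R d k) $ j - c (x k) $ j - gradient (\<lambda>z. c z $ j) (x k) \<bullet> (a *\<^sub>R d k)\<bar>
        \<le> \<Gamma>\<^sub>1 * (norm (a *\<^sub>R d k))\<^sup>2"
      by (rule linear_model_error[OF differentiable(3) X(1,2) in_X gradient_lipschitz(2)[OF _ X(2)] nn(5)])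
    then have "\<bar>c (x k + a *\<^sub>R d k) $ j - (1 - a) * c (x k) $ j\<bar> \<le> \<Gamma>\<^sub>1 * B"
      unfolding norm_eq B_def[symmetric] by (simp add: linearized_constraint algebra_simps)
    then have "\<bar>c (x k + a *\<^sub>R d k) $ j\<bar> \<le> \<bar>(1 - a) * c (x k) $ j\<bar> + \<Gamma>\<^sub>1 * B" by linarith
    then show ?thesis using a by (simp add: abs_mult)
  qed
  have "norm1 (c (x k + a *\<^sub>R d k)) \<le> (\<Sum>j\<in>UNIV. (1 - a) * \<bar>c (x k) $ j\<bar> + \<Gamma>\<^sub>1 * B)"
    by (rule norm1_le_sum) (rule cb)
  also have "\<dots> = (1 - a) * norm1 (c (x k)) + real CARD('m) * (\<Gamma>\<^sub>1 * B)"
    by (simp add: sum.distrib norm1_def sum_distrib_left)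
  finally have 2: "norm1 (c (x k + a *\<^sub>R d k)) \<le> (1 - a) * norm1 (c (x k)) + real CARD('m) * (\<Gamma>\<^sub>1 * B)" .
  show ?thesis
    using 1 2 unfolding merit_def model_reduction_def B_def[symmetric] by (simp add: algebra_simps)
qed

abbreviation (input) "extra k \<equiv> 1/2 * \<tau> k * (d k \<bullet> (hessian f (x k) *v d k))
   + 1/2 * (\<Sum>i\<in>UNIV. \<bar>d k \<bullet> (hessian (\<lambda>z. c z $ i) (x k) *v d k)\<bar>)"

lemma merit_quadratic_model:
  "merit f c (x k + d k) (\<tau> k) \<le> merit f c (x k) (\<tau> k) - \<Delta>l k + extra k
     + (\<tau> 0 * L\<^sub>2 + real CARD('m) * \<Gamma>\<^sub>2) * norm (d k) ^ 3"
proof -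
  note nn = constants_nonneg
  define B where "B = norm (d k) ^ 3"
  have B: "0 \<le> B" by (simp add: B_def)
  have fb: "f (x k + d k) \<le> f (x k) + gradient f (x k) \<bullet> d k
      + 1/2 * (d k \<bullet> (hessian f (x k) *v d k)) + L\<^sub>2 * B"
    using quadratic_model_error[OF f_C2 X(1,2,3) H_lip, of k] unfolding B_def by (simp add: abs_le_iff)
  have "\<tau> k * f (x k + d k) \<le> \<tau> k * (f (x k) + gradient f (x k) \<bullet> d k
      + 1/2 * (d k \<bullet> (hessian f (x k) *v d k)) + L\<^sub>2 * B)"
    using tau_mono(1)[of k] by (intro mult_left_mono fb) simp
  also have "\<dots> = \<tau> k * f (x k) + \<tau> k * (gradient f (x k) \<bullet> d k)
      + 1/2 * \<tau> k * (d k \<bullet> (hessian f (x k) *v d k)) + \<tau> k * (L\<^sub>2 * B)"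
    by (simp add: algebra_simps)
  also have "\<tau> k * (L\<^sub>2 * B) \<le> \<tau> 0 * (L\<^sub>2 * B)"
    using tau_mono(3)[of k] nn B by (intro mult_right_mono) auto
  finally have 1: "\<tau> k * f (x k + d k) \<le> \<tau> k * f (x k) + \<tau> k * (gradient f (x k) \<bullet> d k)
      + 1/2 * \<tau> k * (d k \<bullet> (hessian f (x k) *v d k)) + \<tau> 0 * (L\<^sub>2 * B)" by simp
  have cb: "\<bar>c (x k + d k) $ j\<bar> \<le> 1/2 * \<bar>d k \<bullet> (hessian (\<lambda>z. c z $ j) (x k) *v d k)\<bar> + \<Gamma>\<^sub>2 * B" for j
  proof -
    have "\<bar>c (x k + d k) $ j - c (x k) $ j - gradient (\<lambda>z. c z $ j) (x k) \<bullet> d k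
        - 1/2 * (d k \<bullet> (hessian (\<lambda>z. c z $ j) (x k) *v d k))\<bar> \<le> \<Gamma>\<^sub>2 * B"
      unfolding B_def by (rule quadratic_model_error[OF c_C2 X(1,2,3) Hc_lip])
    then show ?thesis by (simp add: linearized_constraint)
  qed
  have "norm1 (c (x k + d k)) \<le> (\<Sum>j\<in>UNIV. 1/2 * \<bar>d k \<bullet> (hessian (\<lambda>z. c z $ j) (x k) *v d k)\<bar> + \<Gamma>\<^sub>2 * B)"
    by (rule norm1_le_sum) (rule cb)
  also have "\<dots> = 1/2 * (\<Sum>j\<in>UNIV. \<bar>d k \<bullet> (hessian (\<lambda>z. c z $ j) (x k) *v d k)\<bar>) + real CARD('m) * (\<Gamma>\<^sub>2 * B)"
    by (simp only: sum.distrib sum_distrib_left sum_constant)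
  finally show ?thesis
    using 1 unfolding merit_def model_reduction_def B_def[symmetric] by (simp add: algebra_simps)
qed

text \<open>The constant in \<open>extra k = O(norm (d k)\<^sup>2)\<close>.\<close>

definition "E = \<tau> 0 * (L\<^sub>1 + L\<^sub>2 * D) + real CARD('m) * (\<Gamma>\<^sub>1 + \<Gamma>\<^sub>2 * D)"

lemma E_nonneg: "0 \<le> E"
  unfolding E_def using constants_nonneg params(1) by simp

lemma extra_bound: "\<bar>extra k\<bar> \<le> E * (norm (d k))\<^sup>2"
proof -
  note nn = constants_nonneg
  let ?B = "(norm (d k))\<^sup>2"
  have "1/2 * \<bar>d k \<bullet> (hessian f (x k) *v d k)\<bar> \<le> (L\<^sub>1 + L\<^sub>2 * norm (d k)) * ?B"
    by (rule curvature_bound[OF f_C2 X(1,2,3) gradient_lipschitz(1)[OF _ X(2)] nn(3) H_lip])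
  also have "\<dots> \<le> (L\<^sub>1 + L\<^sub>2 * D) * ?B"
    using nn step_bounded by (intro mult_right_mono add_left_mono mult_left_mono) auto
  finally have h: "1/2 * \<bar>d k \<bullet> (hessian f (x k) *v d k)\<bar> \<le> (L\<^sub>1 + L\<^sub>2 * D) * ?B" .
  have "\<bar>1/2 * \<tau> k * (d k \<bullet> (hessian f (x k) *v d k))\<bar> = \<tau> k * (1/2 * \<bar>d k \<bullet> (hessian f (x k) *v d k)\<bar>)"
    using tau_mono(1)[of k] by (simp add: abs_mult)
  also have "\<dots> \<le> \<tau> 0 * ((L\<^sub>1 + L\<^sub>2 * D) * ?B)"
    by (rule mult_mono[OF tau_mono(3) h]) (simp_all add: params(1) less_imp_le)
  finally have 1: "\<bar>1/2 * \<tau> k * (d k \<bullet> (hessian f (x k) *v d k))\<bar> \<le> \<tau> 0 * ((L\<^sub>1 + L\<^sub>2 * D) * ?B)" .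
  have cj: "1/2 * \<bar>d k \<bullet> (hessian (\<lambda>z. c z $ j) (x k) *v d k)\<bar> \<le> (\<Gamma>\<^sub>1 + \<Gamma>\<^sub>2 * D) * ?B" for j
  proof -
    have "1/2 * \<bar>d k \<bullet> (hessian (\<lambda>z. c z $ j) (x k) *v d k)\<bar> \<le> (\<Gamma>\<^sub>1 + \<Gamma>\<^sub>2 * norm (d k)) * ?B"
      by (rule curvature_bound[OF c_C2 X(1,2,3) gradient_lipschitz(2)[OF _ X(2)] nn(5) Hc_lip])
    also have "\<dots> \<le> (\<Gamma>\<^sub>1 + \<Gamma>\<^sub>2 * D) * ?B"
      using nn step_bounded by (intro mult_right_mono add_left_mono mult_left_mono) auto
    finally show ?thesis .
  qed
  have "1/2 * (\<Sum>i\<in>UNIV. \<bar>d k \<bullet> (hessian (\<lambda>z. c z $ i) (x k) *v d k)\<bar>)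
      = (\<Sum>i\<in>UNIV. 1/2 * \<bar>d k \<bullet> (hessian (\<lambda>z. c z $ i) (x k) *v d k)\<bar>)"
    by (rule sum_distrib_left)
  also have "\<dots> \<le> (\<Sum>i\<in>(UNIV::'m set). (\<Gamma>\<^sub>1 + \<Gamma>\<^sub>2 * D) * ?B)" by (rule sum_mono) (rule cj)
  finally have 2: "1/2 * (\<Sum>i\<in>UNIV. \<bar>d k \<bullet> (hessian (\<lambda>z. c z $ i) (x k) *v d k)\<bar>)
      \<le> real CARD('m) * ((\<Gamma>\<^sub>1 + \<Gamma>\<^sub>2 * D) * ?B)" by simp
  have 3: "0 \<le> 1/2 * (\<Sum>i\<in>UNIV. \<bar>d k \<bullet> (hessian (\<lambda>z. c z $ i) (x k) *v d k)\<bar>)"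
    by (simp add: sum_nonneg)
  have "E * ?B = \<tau> 0 * ((L\<^sub>1 + L\<^sub>2 * D) * ?B) + real CARD('m) * ((\<Gamma>\<^sub>1 + \<Gamma>\<^sub>2 * D) * ?B)"
    unfolding E_def by (simp add: algebra_simps)
  then show ?thesis using 1 2 3 by linarith
qed

lemma cond_B_extra: "cond_B f c \<eta> (x k) (\<tau> k) (gradient f (x k)) (hessian f (x k)) (d k) 0 a
  \<longleftrightarrow> merit f c (x k + a *\<^sub>R d k) (\<tau> k) \<le> merit f c (x k) (\<tau> k) - \<eta> * a * \<Delta>l k + a\<^sup>2 * extra k"
  unfolding cond_B_def by (simp add: algebra_simps)

lemma reduction_nonneg: "0 \<le> \<Delta>l k"
  using reduction[of k] params(13) tau_mono(1)[of k]
  by (smt (verit) mult_nonneg_nonneg zero_le_power2)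

text \<open>The model reduction is at least of order \<open>norm (d k)\<^sup>2\<close> because the merit parameter stays
  away from zero. For small \<open>a\<close>, the share \<open>(1 - \<eta>) a\<close> of it therefore covers all terms of order
  \<open>a\<^sup>2 norm (d k)\<^sup>2\<close>, and both conditions hold.\<close>

lemma step_sizes_bounded: "\<exists>a>0. \<forall>k. a \<le> \<alpha> k" "0 < \<alpha> k" "\<alpha> k \<le> 1"
proof -
  note nn = constants_nonneg
  obtain t where t: "0 < t" "\<And>k. t \<le> \<tau> k" using tau_bounded_below by blast
  \<comment> \<open>the summand \<open>E\<close> pays for a negative extra term in condition (B)\<close>
  define C where "C = \<tau> 0 * L\<^sub>1 + real CARD('m) * \<Gamma>\<^sub>1 + E + 1"
  have "0 \<le> \<tau> 0 * L\<^sub>1 + real CARD('m) * \<Gamma>\<^sub>1" using nn params(1) by simp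
  then have C: "0 < C" using E_nonneg by (simp add: C_def)
  define a0 where "a0 = (1 - \<eta>) * \<kappa>\<^sub>l * t / C"
  have a0: "0 < a0" using params t C by (simp add: a0_def)
  have small: "merit f c (x k + a *\<^sub>R d k) (\<tau> k)
      \<le> merit f c (x k) (\<tau> k) - \<eta> * a * \<Delta>l k - E * (a * norm (d k))\<^sup>2"
    if a: "0 < a" "a \<le> 1" "a \<le> a0" for a k
  proof -
    let ?B = "(a * norm (d k))\<^sup>2"
    have "C * a \<le> (1 - \<eta>) * \<kappa>\<^sub>l * t" using a C by (simp add: a0_def field_simps)
    then have "C * a * (a * (norm (d k))\<^sup>2) \<le> (1 - \<eta>) * \<kappa>\<^sub>l * t * (a * (norm (d k))\<^sup>2)"
      using a by (intro mult_right_mono) auto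
    also have "\<dots> = (1 - \<eta>) * a * (\<kappa>\<^sub>l * t * (norm (d k))\<^sup>2)" by simp
    also have "\<dots> \<le> (1 - \<eta>) * a * \<Delta>l k"
    proof (intro mult_left_mono)
      have "\<kappa>\<^sub>l * t * (norm (d k))\<^sup>2 \<le> \<kappa>\<^sub>l * \<tau> k * (norm (d k))\<^sup>2"
        using t params by (intro mult_right_mono mult_left_mono) auto
      then show "\<kappa>\<^sub>l * t * (norm (d k))\<^sup>2 \<le> \<Delta>l k" using reduction[of k] by linarith
    qed (use a params in auto)
    finally have "C * ?B \<le> a * \<Delta>l k - \<eta> * a * \<Delta>l k"
      by (simp add: algebra_simps power2_eq_square)
    moreover have "C * ?B = (\<tau> 0 * L\<^sub>1 + real CARD('m) * \<Gamma>\<^sub>1) * ?B + E * ?B + ?B"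
      unfolding C_def by (simp add: algebra_simps)
    moreover have "0 \<le> ?B" by simp
    ultimately show ?thesis using merit_linear_model[of a k] a by linarith
  qed
  have A: "cond_A f c \<eta> (x k) (\<tau> k) (gradient f (x k)) (d k) 0 a" if "0 < a" "a \<le> 1" "a \<le> a0" for a k
    using small[OF that, of k] E_nonneg unfolding cond_A_def
    by (smt (verit) mult_nonneg_nonneg zero_le_power2)
  have B: "cond_B f c \<eta> (x k) (\<tau> k) (gradient f (x k)) (hessian f (x k)) (d k) 0 a"
    if "0 < a" "a \<le> 1" "a \<le> a0" for a k
  proof -
    have "a\<^sup>2 * - extra k \<le> a\<^sup>2 * (E * (norm (d k))\<^sup>2)"
      by (intro mult_left_mono order_trans[OF abs_ge_minus_self extra_bound]) simp
    also have "\<dots> = E * (a * norm (d k))\<^sup>2" by (simp add: power_mult_distrib)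
    finally have "- (E * (a * norm (d k))\<^sup>2) \<le> a\<^sup>2 * extra k"
      by (simp only: mult_minus_right minus_le_iff)
    then show ?thesis unfolding cond_B_extra using small[OF that, of k] by linarith
  qed
  have all: "min 1 (\<nu>\<^sub>\<alpha> * a0) \<le> \<alpha> k \<and> 0 < \<alpha> k \<and> \<alpha> k \<le> 1" for k
    using line_search[of k] backtracked_bounds[OF _ params(3,4) A] backtracked_bounds[OF _ params(3,4) B]
    by (auto split: if_splits)
  have "0 < min 1 (\<nu>\<^sub>\<alpha> * a0)" using a0 params by simp
  with all show "\<exists>a>0. \<forall>k. a \<le> \<alpha> k" by blast
  show "0 < \<alpha> k" "\<alpha> k \<le> 1" using all by auto
qed

lemma gamma_pos: "0 < \<gamma> k"
proof (induction k)
  case (Suc k)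
  then show ?case using line_search[of k] params by (auto split: if_splits)
qed (rule params)

text \<open>Condition (B) permits the merit function to grow, by at most \<open>E (\<gamma> k)\<^sup>2\<close> since it is used only
  for directions below the threshold. Each such step multiplies the threshold by \<open>\<nu>\<^sub>\<gamma>\<close>, and the
  coefficient of \<open>(\<gamma> k)\<^sup>2\<close> is chosen so that the last summand falls by exactly the permitted growth.
  The shift by \<open>\<kappa>\<^sub>f\<close> makes the factor of \<open>\<tau> k\<close> nonnegative, so that a decrease of the merit parameter
  is a decrease of the potential.\<close>

definition "\<Phi> k = \<tau> k * (f (x k) + \<kappa>\<^sub>f) + norm1 (c (x k)) + E / (1 - \<nu>\<^sub>\<gamma>\<^sup>2) * (\<gamma> k)\<^sup>2"

lemma potential_decrease: "0 \<le> \<Phi> k" "\<Phi> (Suc k) \<le> \<Phi> k - \<eta> * \<alpha> k * \<Delta>l k"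
proof -
  have nu: "0 < 1 - \<nu>\<^sub>\<gamma>\<^sup>2" using params by (simp add: power_less_one_iff)
  have fpos: "0 \<le> f (x k) + \<kappa>\<^sub>f" for k using f_bound[OF X(2)[of k]] by (simp add: abs_le_iff)
  show "0 \<le> \<Phi> k" unfolding \<Phi>_def
    using fpos[of k] tau_mono(1)[of k] norm1_nonneg[of "c (x k)"] E_nonneg nu by simp
  define b where "b = E / (1 - \<nu>\<^sub>\<gamma>\<^sup>2)"
  have b: "b * \<nu>\<^sub>\<gamma>\<^sup>2 = b - E" using nu by (simp add: b_def field_simps)
  have main: "merit f c (x (Suc k)) (\<tau> k) + b * (\<gamma> (Suc k))\<^sup>2
      \<le> merit f c (x k) (\<tau> k) - \<eta> * \<alpha> k * \<Delta>l k + b * (\<gamma> k)\<^sup>2"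
  proof -
    consider (A) "cond_A f c \<eta> (x k) (\<tau> k) (gradient f (x k)) (d k) 0 (\<alpha> k)" "\<gamma> (Suc k) = \<gamma> k"
      | (B) "cond_B f c \<eta> (x k) (\<tau> k) (gradient f (x k)) (hessian f (x k)) (d k) 0 (\<alpha> k)"
          "\<gamma> (Suc k) = \<nu>\<^sub>\<gamma> * \<gamma> k" "norm (d k) \<le> \<gamma> k"
      using line_search[of k] backtracked_accepted by (auto split: if_splits)
    then show ?thesis
    proof cases
      case A
      then show ?thesis by (simp add: cond_A_def x_Suc)
    next
      case B
      have "(\<alpha> k)\<^sup>2 * extra k \<le> 1 * \<bar>extra k\<bar>"
        using step_sizes_bounded(2,3)[of k]
        by (intro order_trans[OF mult_left_mono[OF abs_ge_self] mult_right_mono])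
           (auto simp: power_le_one)
      also have "\<dots> \<le> E * (norm (d k))\<^sup>2" using extra_bound[of k] by simp
      also have "\<dots> \<le> E * (\<gamma> k)\<^sup>2" using B(3) E_nonneg by (intro mult_left_mono power_mono) auto
      finally have "(\<alpha> k)\<^sup>2 * extra k \<le> E * (\<gamma> k)\<^sup>2" .
      moreover have "b * (\<gamma> (Suc k))\<^sup>2 = b * (\<gamma> k)\<^sup>2 - E * (\<gamma> k)\<^sup>2"
        unfolding B(2) power_mult_distrib mult.assoc[symmetric] b by (rule left_diff_distrib)
      ultimately show ?thesis using B(1) unfolding cond_B_extra x_Suc by linarith
    qed
  qed
  have "\<tau> (Suc k) * (f (x (Suc k)) + \<kappa>\<^sub>f) \<le> \<tau> k * (f (x (Suc k)) + \<kappa>\<^sub>f)"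
    by (intro mult_right_mono tau_mono fpos)
  then show "\<Phi> (Suc k) \<le> \<Phi> k - \<eta> * \<alpha> k * \<Delta>l k"
    using main unfolding \<Phi>_def merit_def b_def[symmetric] distrib_left by linarith
qed

lemma step_tendsto_zero: "d \<longlonglongrightarrow> 0"
proof -
  obtain t where t: "0 < t" "\<And>k. t \<le> \<tau> k" using tau_bounded_below by blast
  obtain a where a: "0 < a" "\<And>k. a \<le> \<alpha> k" using step_sizes_bounded(1) by blast
  define C where "C = \<eta> * a * (\<kappa>\<^sub>l * t)"
  have C: "0 < C" using params t a by (simp add: C_def)
  have "(\<lambda>k. \<eta> * \<alpha> k * \<Delta>l k) \<longlonglongrightarrow> 0"
    by (rule decreasing_potential_tendsto_zero[where \<Phi> = \<Phi>])
       (simp_all add: potential_decrease reduction_nonneg params step_sizes_bounded(2) less_imp_le)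
  then have lim: "(\<lambda>k. (\<eta> * \<alpha> k * \<Delta>l k) / C) \<longlonglongrightarrow> 0"
    by (rule tendsto_divide_zero)
  have "(norm (d k))\<^sup>2 \<le> (\<eta> * \<alpha> k * \<Delta>l k) / C" for k
  proof -
    have "\<eta> * a * (\<kappa>\<^sub>l * t * (norm (d k))\<^sup>2) \<le> \<eta> * \<alpha> k * \<Delta>l k"
    proof (rule mult_mono)
      have "\<kappa>\<^sub>l * t * (norm (d k))\<^sup>2 \<le> \<kappa>\<^sub>l * \<tau> k * (norm (d k))\<^sup>2"
        using t params by (intro mult_right_mono mult_left_mono) auto
      then show "\<kappa>\<^sub>l * t * (norm (d k))\<^sup>2 \<le> \<Delta>l k" using reduction[of k] by linarith
    qed (use a t params step_sizes_bounded(2)[of k] in auto)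
    then have "(norm (d k))\<^sup>2 * C \<le> \<eta> * \<alpha> k * \<Delta>l k" by (simp add: C_def mult_ac)
    then show ?thesis using C by (simp only: pos_le_divide_eq)
  qed
  then have "(\<lambda>k. (norm (d k))\<^sup>2) \<longlonglongrightarrow> 0"
    by (intro Lim_null_comparison[OF _ lim] always_eventually allI) simp
  then have "(\<lambda>k. norm (d k)) \<longlonglongrightarrow> 0" using tendsto_real_sqrt by fastforce
  then show ?thesis by (simp add: tendsto_norm_zero_iff)
qed

end

section \<open>Local superlinear convergence\<close>

text \<open>The constant \<open>\<mu>\<close> is \<open>\<mu>\<^sub>M / 2\<close> of the growth condition. The direction computed from full samples
  solves the exact system, so it may be used as the direction in that condition.\<close>

locale exact_sqp_growth = exact_sqp f c X J W x d y \<delta>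
  for f :: "real^'n \<Rightarrow> real" and c :: "real^'n \<Rightarrow> real^'m" and X J W x d y \<delta> +
  fixes xs :: "real^'n" and ys :: "real^'m" and \<kappa>\<^sub>d \<mu> :: real
  assumes stationary: "gradient f xs + transpose (J xs) *v ys = 0" "c xs = 0"
    and growth_pos: "0 < \<kappa>\<^sub>d" "0 < \<mu>"
    and growth: "\<And>k. norm (d k) \<le> \<kappa>\<^sub>d \<Longrightarrow> \<mu> * norm (stack (x k) (y k) - stack xs ys)
        \<le> norm (stack (gradient f (x k) + transpose (J (x k)) *v y k) (c (x k)))"
begin

text \<open>After the step \<open>k\<close>, the new multiplier \<open>y (Suc k)\<close> makes the gradient of the Lagrangian
  at the old point equal to \<open>- W k *v d k\<close>. Moving to the new point changes it by
  \<open>O(norm (d k))\<close>.\<close>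

lemma residual_bound:
  "norm (stack (gradient f (x (Suc k)) + transpose (J (x (Suc k))) *v y (Suc k)) (c (x (Suc k))))
    \<le> (L\<^sub>1 + \<Gamma>\<^sub>1 * D + \<kappa>\<^sub>M) * norm (d k) + \<kappa>\<^sub>M * norm (d (Suc k))"
proof -
  note nn = constants_nonneg
  have dist: "norm (x (Suc k) - x k) \<le> norm (d k)"
    using step_sizes_bounded(2,3)[of k] by (simp add: x_Suc mult_left_le_one_le)
  have rows: "W k *v d k + transpose (J (x k)) *v y (Suc k) = - gradient f (x k)"
    "J (x (Suc k)) *v d (Suc k) = - c (x (Suc k))"
    using kkt_step_rows[OF kkt_lower kkt_upper step] by (simp_all add: y_Suc)
  have "gradient f (x (Suc k)) + transpose (J (x (Suc k))) *v y (Suc k)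
     = (gradient f (x (Suc k)) - gradient f (x k))
       + transpose (J (x (Suc k)) - J (x k)) *v y (Suc k)
       + (gradient f (x k) + transpose (J (x k)) *v y (Suc k))"
    by (simp add: transpose_mult_vec_rows scaleR_diff_right sum_subtractf
        del: transpose_matrix_vector)
  also have "gradient f (x k) + transpose (J (x k)) *v y (Suc k) = - (W k *v d k)"
    using rows(1) by (simp add: eq_neg_iff_add_eq_0 add_ac del: transpose_matrix_vector)
  finally have split: "gradient f (x (Suc k)) + transpose (J (x (Suc k))) *v y (Suc k)
     = (gradient f (x (Suc k)) - gradient f (x k))
       + transpose (J (x (Suc k)) - J (x k)) *v y (Suc k) + - (W k *v d k)" .
  have "norm (gradient f (x (Suc k)) + transpose (J (x (Suc k))) *v y (Suc k))
      \<le> norm (gradient f (x (Suc k)) - gradient f (x k))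
       + norm (transpose (J (x (Suc k)) - J (x k)) *v y (Suc k)) + norm (W k *v d k)"
    unfolding split by (rule norm_triangle_le, rule add_mono, rule norm_triangle_ineq, simp)
  moreover have "norm (gradient f (x (Suc k)) - gradient f (x k)) \<le> L\<^sub>1 * norm (d k)"
    using gradient_lipschitz(1)[OF X(2,2), of "Suc k" k] dist nn
    by (meson mult_left_mono order_trans)
  moreover have "norm (transpose (J (x (Suc k)) - J (x k)) *v y (Suc k)) \<le> (\<Gamma>\<^sub>1 * norm (d k)) * D"
  proof -
    have "norm (transpose (J (x (Suc k)) - J (x k)) *v y (Suc k))
        \<le> spectral_norm (J (x (Suc k)) - J (x k)) * norm (y (Suc k))"
      by (rule norm_transpose_mult_vec_le)
    also have "\<dots> \<le> (\<Gamma>\<^sub>1 * norm (d k)) * D"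
    proof (rule mult_mono)
      show "spectral_norm (J (x (Suc k)) - J (x k)) \<le> \<Gamma>\<^sub>1 * norm (d k)"
        using spectral_lipschitz_onD[OF J_lip X(2,2), of "Suc k" k] dist nn
        by (meson mult_left_mono order_trans)
    qed (use step_bounded(2)[of k] nn in \<open>auto simp: y_Suc\<close>)
    finally show ?thesis .
  qed
  moreover have "norm (W k *v d k) \<le> \<kappa>\<^sub>M * norm (d k)"
    by (rule kkt_block_bounds[OF kkt_lower kkt_upper])
  moreover have "norm (c (x (Suc k))) \<le> \<kappa>\<^sub>M * norm (d (Suc k))"
    using kkt_block_bounds(2)[OF kkt_lower kkt_upper, of "Suc k" "d (Suc k)"] rows(2) by simp
  ultimately show ?thesis
    using norm_stack_le[of "gradient f (x (Suc k)) + transpose (J (x (Suc k))) *v y (Suc k)" "c (x (Suc k))"]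
    by (simp add: algebra_simps del: transpose_matrix_vector)
qed

lemma iterates_converge: "(\<lambda>k. norm (stack (x k) (y k) - stack xs ys)) \<longlonglongrightarrow> 0"
proof -
  have d: "(\<lambda>k. norm (d k)) \<longlonglongrightarrow> 0"
    using step_tendsto_zero by (simp add: tendsto_norm_zero_iff)
  have "(\<lambda>k. (L\<^sub>1 + \<Gamma>\<^sub>1 * D + \<kappa>\<^sub>M) * norm (d k) + \<kappa>\<^sub>M * norm (d (Suc k)))
      \<longlonglongrightarrow> (L\<^sub>1 + \<Gamma>\<^sub>1 * D + \<kappa>\<^sub>M) * 0 + \<kappa>\<^sub>M * 0"
    by (intro tendsto_intros d LIMSEQ_Suc[OF d])
  then have lim: "(\<lambda>k. ((L\<^sub>1 + \<Gamma>\<^sub>1 * D + \<kappa>\<^sub>M) * norm (d k) + \<kappa>\<^sub>M * norm (d (Suc k))) / \<mu>) \<longlonglongrightarrow> 0"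
    by (intro tendsto_divide_zero) simp
  have "\<forall>\<^sub>F k in sequentially. norm (d (Suc k)) < \<kappa>\<^sub>d"
    using order_tendstoD(2)[OF LIMSEQ_Suc[OF d] growth_pos(1)] .
  then have "\<forall>\<^sub>F k in sequentially. norm (norm (stack (x (Suc k)) (y (Suc k)) - stack xs ys))
      \<le> ((L\<^sub>1 + \<Gamma>\<^sub>1 * D + \<kappa>\<^sub>M) * norm (d k) + \<kappa>\<^sub>M * norm (d (Suc k))) / \<mu>"
  proof eventually_elim
    case (elim k)
    then have "\<mu> * norm (stack (x (Suc k)) (y (Suc k)) - stack xs ys)
       \<le> (L\<^sub>1 + \<Gamma>\<^sub>1 * D + \<kappa>\<^sub>M) * norm (d k) + \<kappa>\<^sub>M * norm (d (Suc k))"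
      by (intro order_trans[OF growth residual_bound]) simp
    then show ?case using growth_pos by (simp add: pos_le_divide_eq mult.commute)
  qed
  then have "(\<lambda>k. norm (stack (x (Suc k)) (y (Suc k)) - stack xs ys)) \<longlonglongrightarrow> 0"
    by (rule Lim_null_comparison[OF _ lim])
  then show ?thesis by (rule LIMSEQ_imp_Suc)
qed

lemma primal_dual_converge: "x \<longlonglongrightarrow> xs" "y \<longlonglongrightarrow> ys"
proof -
  have "norm (x k - xs) \<le> norm (stack (x k) (y k) - stack xs ys)"
    "norm (y k - ys) \<le> norm (stack (x k) (y k) - stack xs ys)" for k
    by (simp_all add: stack_arith norm_le_stack)
  then have "(\<lambda>k. x k - xs) \<longlonglongrightarrow> 0" "(\<lambda>k. y k - ys) \<longlonglongrightarrow> 0"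
    by (auto intro: Lim_null_comparison[OF _ iterates_converge])
  then show "x \<longlonglongrightarrow> xs" "y \<longlonglongrightarrow> ys" by (simp_all add: LIM_zero_iff)
qed

text \<open>The error of a full step is the inverse KKT matrix applied to linearization errors of
  \<open>f\<close>'s gradient, of the constraint gradients and of \<open>c\<close>, all of them taken along \<open>x k - xs\<close>.
  Since the KKT residual is affine in the multiplier, the multiplier error enters only through
  a product with \<open>x k - xs\<close>. Hence the new error is small relative to the primal error alone,
  which is more than superlinearity of the primal-dual error.\<close>

lemma full_step_error:
  assumes e: "0 < e"
  shows "\<forall>\<^sub>F k in sequentially. norm (stack (x k + d k - xs) (y k + \<delta> k - ys)) \<le> e * norm (x k - xs)"
proof -
  note nn = constants_nonneg
  note conv = primal_dual_converge
  define S where "S = 1 + (\<Sum>i\<in>(UNIV::'m set). \<bar>ys $ i\<bar> + 1) + 1"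
  have S: "0 < S" unfolding S_def by (simp add: sum_nonneg add_pos_nonneg add_nonneg_pos)
  \<comment> \<open>\<open>S\<close> adds up the weights of the linearization errors; \<open>\<Lambda> + 1\<close> is positive even for \<open>\<Lambda> = 0\<close>\<close>
  define e' where "e' = e / ((\<Lambda> + 1) * S)"
  have e': "0 < e'" using e nn S by (simp add: e'_def)
  have cont: "isCont (hessian f) xs" "\<And>j. isCont (hessian (\<lambda>z. c z $ j)) xs"
    using f_C2 c_C2 by (auto simp: twice_cont_diff_on_def continuous_on_eq_continuous_at)
  have grad_cont: "isCont (gradient (\<lambda>z. c z $ j)) xs" for j
    using differentiable(4) by (rule differentiable_imp_continuous_within)
  have J_cont: "isCont J xs"
    unfolding isCont_def
  proof (rule vec_tendstoI)
    show "((\<lambda>z. J z $ j) \<longlongrightarrow> J xs $ j) (at xs)" for j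
      using grad_cont[of j] by (simp add: J_row isCont_def)
  qed
  have "\<forall>\<^sub>F k in sequentially.
      norm (hessian f (x k) *v (x k - xs) - (gradient f (x k) - gradient f xs)) \<le> e' * norm (x k - xs)"
    by (rule strict_linearization[OF has_derivative_hessian[OF differentiable(2)] cont(1) conv(1) e'])
  moreover have "\<forall>\<^sub>F k in sequentially. \<forall>j\<in>UNIV.
      norm (hessian (\<lambda>z. c z $ j) (x k) *v (x k - xs) - (gradient (\<lambda>z. c z $ j) (x k) - gradient (\<lambda>z. c z $ j) xs))
        \<le> e' * norm (x k - xs)"
    by (intro eventually_ball_finite ballI finite
        strict_linearization[OF has_derivative_hessian[OF differentiable(4)] cont(2) conv(1) e'])
  moreover have "\<forall>\<^sub>F k in sequentially. norm (J (x k) *v (x k - xs) - (c (x k) - c xs)) \<le> e' * norm (x k - xs)"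
    by (rule strict_linearization[OF c_deriv J_cont conv(1) e'])
  moreover have "\<forall>\<^sub>F k in sequentially. \<forall>j\<in>UNIV. \<bar>y k $ j - ys $ j\<bar> * norm (hessian (\<lambda>z. c z $ j) (x k)) < e'"
  proof (intro eventually_ball_finite ballI finite)
    fix j
    have "(\<lambda>k. \<bar>y k $ j - ys $ j\<bar> * norm (hessian (\<lambda>z. c z $ j) (x k)))
        \<longlonglongrightarrow> \<bar>ys $ j - ys $ j\<bar> * norm (hessian (\<lambda>z. c z $ j) xs)"
      by (intro tendsto_intros conv isCont_tendsto_compose[OF cont(2)])
    then show "\<forall>\<^sub>F k in sequentially. \<bar>y k $ j - ys $ j\<bar> * norm (hessian (\<lambda>z. c z $ j) (x k)) < e'"
      using e' by (intro order_tendstoD(2)) auto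
  qed
  ultimately show ?thesis
  proof eventually_elim
    case (elim k)
    define h where "h = x k - xs"
    let ?H = "\<lambda>j. hessian (\<lambda>z. c z $ j) (x k)"
    let ?G = "\<lambda>j. gradient (\<lambda>z. c z $ j)"
    let ?r = "hessian f (x k) *v h - (gradient f (x k) - gradient f xs)"
    let ?s = "\<lambda>j. ?H j *v h - (?G j (x k) - ?G j xs)"
    let ?K = "kkt_matrix (W k) (J (x k))"
    have "?K *v stack (x k + d k - xs) (y k + \<delta> k - ys) = ?K *v (stack (d k) (\<delta> k) + stack h (y k - ys))"
      by (simp add: stack_arith h_def algebra_simps)
    also have "\<dots> = ?K *v stack (d k) (\<delta> k) + ?K *v stack h (y k - ys)"
      by (rule matrix_vector_right_distrib)
    also have "\<dots> = stack (W k *v h + transpose (J (x k)) *v (y k - ys)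
          - (gradient f (x k) + transpose (J (x k)) *v y k)) (J (x k) *v h - c (x k))"
      unfolding step by (simp only: kkt_matrix_mult_stack stack_arith uminus_add_conv_diff)
    also have "W k *v h + transpose (J (x k)) *v (y k - ys) - (gradient f (x k) + transpose (J (x k)) *v y k)
        = ?r + (\<Sum>j\<in>UNIV. ys $ j *\<^sub>R ?s j + (y k $ j - ys $ j) *\<^sub>R (?H j *v h))"
    proof -
      have Wh: "W k *v h = hessian f (x k) *v h + (\<Sum>j\<in>UNIV. y k $ j *\<^sub>R (?H j *v h))"
        unfolding W_def by (simp add: matrix_vector_mult_add_rdistrib matrix_sum_mult_vec scaleR_matrix_vector_assoc)
      have gs: "gradient f xs = - (\<Sum>j\<in>UNIV. ys $ j *\<^sub>R ?G j xs)"
        using stationary(1) unfolding transpose_mult_vec_rows J_row by (simp add: eq_neg_iff_add_eq_0)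
      show ?thesis
        unfolding Wh gs transpose_mult_vec_rows J_row
        by (simp add: algebra_simps sum.distrib sum_subtractf)
    qed
    also have "J (x k) *v h - c (x k) = J (x k) *v h - (c (x k) - c xs)" by (simp add: stationary)
    finally have eq: "?K *v stack (x k + d k - xs) (y k + \<delta> k - ys)
      = stack (?r + (\<Sum>j\<in>UNIV. ys $ j *\<^sub>R ?s j + (y k $ j - ys $ j) *\<^sub>R (?H j *v h)))
          (J (x k) *v h - (c (x k) - c xs))" .
    have "norm (ys $ j *\<^sub>R ?s j + (y k $ j - ys $ j) *\<^sub>R (?H j *v h)) \<le> (\<bar>ys $ j\<bar> + 1) * (e' * norm h)" for j
    proof -
      have "norm (ys $ j *\<^sub>R ?s j) \<le> \<bar>ys $ j\<bar> * (e' * norm h)"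
        using elim(2) unfolding h_def[symmetric] by (simp add: mult_left_mono)
      moreover have "norm ((y k $ j - ys $ j) *\<^sub>R (?H j *v h)) \<le> 1 * (e' * norm h)"
      proof -
        have "norm ((y k $ j - ys $ j) *\<^sub>R (?H j *v h)) \<le> \<bar>y k $ j - ys $ j\<bar> * (norm (?H j) * norm h)"
          using order_trans[OF norm_mult_vec_le_spectral[of "?H j" h]
              mult_right_mono[OF spectral_norm_le_norm norm_ge_zero]]
          by (simp add: mult_left_mono)
        also have "\<dots> = (\<bar>y k $ j - ys $ j\<bar> * norm (?H j)) * norm h" by simp
        also have "\<dots> \<le> e' * norm h"
          using elim(4) by (intro mult_right_mono) (auto simp: less_imp_le)
        finally show ?thesis by simp
      qed
      ultimately show ?thesis
        unfolding distrib_right by (rule norm_triangle_mono)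
    qed
    then have "norm (\<Sum>j\<in>UNIV. ys $ j *\<^sub>R ?s j + (y k $ j - ys $ j) *\<^sub>R (?H j *v h))
       \<le> (\<Sum>j\<in>UNIV. \<bar>ys $ j\<bar> + 1) * (e' * norm h)"
      unfolding sum_distrib_right by (rule sum_norm_le)
    moreover have "norm ?r \<le> e' * norm h" using elim(1) by (simp add: h_def)
    moreover have "norm (J (x k) *v h - (c (x k) - c xs)) \<le> e' * norm h" using elim(3) by (simp add: h_def)
    ultimately have "norm (?K *v stack (x k + d k - xs) (y k + \<delta> k - ys)) \<le> S * (e' * norm h)"
      unfolding eq S_def distrib_right mult_1
      by (intro order_trans[OF norm_stack_le] add_mono norm_triangle_le)
    then have "norm (stack (x k + d k - xs) (y k + \<delta> k - ys)) \<le> \<Lambda> * (S * (e' * norm h))"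
      using nn(1) by (rule order_trans[OF kkt_lower mult_left_mono])
    also have "\<dots> \<le> (\<Lambda> + 1) * (S * (e' * norm h))"
      using S e' by (intro mult_right_mono) auto
    also have "\<dots> = e * norm h" using nn S by (simp add: e'_def)
    finally show ?case by (simp add: h_def)
  qed
qed

text \<open>For a short direction the cubic error of the quadratic model is dominated by the model
  reduction, which is quadratic; so condition (B) accepts the unit step.\<close>

lemma unit_step_below_threshold:
  "\<forall>\<^sub>F k in sequentially. norm (d k) \<le> \<gamma> k \<longrightarrow> \<alpha> k = 1 \<and> \<nu>\<^sub>\<gamma> * \<gamma> k \<le> \<gamma> (Suc k)"
proof -
  obtain t where t: "0 < t" "\<And>k. t \<le> \<tau> k" using tau_bounded_below by blast
  define C where "C = \<tau> 0 * L\<^sub>2 + real CARD('m) * \<Gamma>\<^sub>2"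
  define b where "b = (1 - \<eta>) * (\<kappa>\<^sub>l * t)"
  have b: "0 < b" using params t by (simp add: b_def)
  have d: "(\<lambda>k. norm (d k)) \<longlonglongrightarrow> 0"
    using step_tendsto_zero by (simp add: tendsto_norm_zero_iff)
  have "(\<lambda>k. C * norm (d k)) \<longlonglongrightarrow> C * 0" by (intro tendsto_intros d)
  then have "\<forall>\<^sub>F k in sequentially. C * norm (d k) < b"
    using b by (intro order_tendstoD(2)) auto
  then show ?thesis
  proof eventually_elim
    case (elim k)
    have "C * norm (d k) ^ 3 = C * norm (d k) * (norm (d k))\<^sup>2"
      by (simp add: power2_eq_square power3_eq_cube)
    also have "\<dots> \<le> b * (norm (d k))\<^sup>2" using elim by (intro mult_right_mono) auto
    also have "\<dots> = (1 - \<eta>) * (\<kappa>\<^sub>l * t * (norm (d k))\<^sup>2)" by (simp add: b_def)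
    also have "\<dots> \<le> (1 - \<eta>) * \<Delta>l k"
    proof (rule mult_left_mono)
      have "\<kappa>\<^sub>l * t * (norm (d k))\<^sup>2 \<le> \<kappa>\<^sub>l * \<tau> k * (norm (d k))\<^sup>2"
        using t params by (intro mult_right_mono mult_left_mono) auto
      then show "\<kappa>\<^sub>l * t * (norm (d k))\<^sup>2 \<le> \<Delta>l k" using reduction[of k] by linarith
    qed (use params in simp)
    finally have "C * norm (d k) ^ 3 \<le> \<Delta>l k - \<eta> * \<Delta>l k" by (simp add: left_diff_distrib)
    then have "cond_B f c \<eta> (x k) (\<tau> k) (gradient f (x k)) (hessian f (x k)) (d k) 0 1"
      using merit_quadratic_model[of k] unfolding cond_B_extra C_def[symmetric]
      by (simp only: scaleR_one mult_1_right mult_1 power_one)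
    then show ?case
      using line_search[of k] backtracked_full gamma_pos[of k] params
      by (auto split: if_splits simp: mult_left_le_one_le)
  qed
qed

text \<open>With a full step at \<open>k\<close> the next primal error is much smaller than the current one, and
  each primal error is comparable with the length of the direction computed there.\<close>

lemma direction_shrinks:
  "\<forall>\<^sub>F k in sequentially. \<alpha> k = 1 \<longrightarrow> norm (d (Suc k)) \<le> \<nu>\<^sub>\<gamma> * norm (d k)"
proof -
  \<comment> \<open>one factor \<open>2\<close> is lost on either side when errors are compared with directions\<close>
  define e where "e = \<nu>\<^sub>\<gamma> / 4"
  have e: "0 < e" "e \<le> 1/4" using params by (simp_all add: e_def)
  have "\<forall>\<^sub>F k in sequentially. norm (x k + d k - xs) \<le> e * norm (x k - xs)"
    by (rule eventually_mono[OF full_step_error[OF e(1)]]) (rule order_trans[OF norm_le_stack(1)])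
  moreover from this have "\<forall>\<^sub>F k in sequentially. norm (x (Suc k) + d (Suc k) - xs) \<le> e * norm (x (Suc k) - xs)"
    by (subst eventually_sequentially_Suc)
  ultimately show ?thesis
  proof eventually_elim
    case (elim k)
    show ?case
    proof
      assume "\<alpha> k = 1"
      then have x': "x (Suc k) = x k + d k" by (simp add: x_Suc)
      let ?h = "norm (x k - xs)" and ?h' = "norm (x (Suc k) - xs)"
      have h': "?h' \<le> e * ?h" using elim(1) by (simp add: x')
      have "?h \<le> norm (d k) + norm (x k + d k - xs)"
        using norm_triangle_ineq4[of "x k + d k - xs" "d k"] by (simp add: algebra_simps)
      then have "?h \<le> norm (d k) + e * ?h" using elim(1) by linarith
      moreover have "e * ?h \<le> 1/4 * ?h" using e by (intro mult_right_mono) auto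
      ultimately have h: "?h \<le> 2 * norm (d k)" using norm_ge_zero[of "x k - xs"] by linarith
      have "norm (d (Suc k)) \<le> ?h' + norm (x (Suc k) + d (Suc k) - xs)"
        using norm_triangle_ineq4[of "x (Suc k) + d (Suc k) - xs" "x (Suc k) - xs"] by (simp add: algebra_simps)
      also have "\<dots> \<le> ?h' + e * ?h'" using elim(2) by simp
      also have "e * ?h' \<le> 1 * ?h'" using e by (intro mult_right_mono) auto
      finally have "norm (d (Suc k)) \<le> 2 * (e * (2 * norm (d k)))"
        using h' mult_left_mono[OF h, of e] e by linarith
      then show "norm (d (Suc k)) \<le> \<nu>\<^sub>\<gamma> * norm (d k)" by (simp add: e_def)
    qed
  qed
qed

text \<open>The threshold \<open>\<gamma>\<close> stays constant as long as the direction is longer than it, which cannot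
  last since the direction tends to zero. Once the direction is below the threshold, it shrinks at
  least as fast as the threshold and never leaves.\<close>

lemma unit_steps_eventually: "\<forall>\<^sub>F k in sequentially. \<alpha> k = 1"
proof -
  obtain K where K: "\<And>k. \<lbrakk>K \<le> k; norm (d k) \<le> \<gamma> k\<rbrakk> \<Longrightarrow> \<alpha> k = 1 \<and> \<nu>\<^sub>\<gamma> * \<gamma> k \<le> \<gamma> (Suc k)"
    and K': "\<And>k. \<lbrakk>K \<le> k; \<alpha> k = 1\<rbrakk> \<Longrightarrow> norm (d (Suc k)) \<le> \<nu>\<^sub>\<gamma> * norm (d k)"
    using eventually_conj[OF unit_step_below_threshold direction_shrinks]
    unfolding eventually_sequentially by blast
  have "\<exists>k\<ge>K. norm (d k) \<le> \<gamma> k"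
  proof (rule ccontr)
    assume "\<not> ?thesis"
    then have long: "\<gamma> k < norm (d k)" if "K \<le> k" for k using that by force
    have "\<gamma> k = \<gamma> K" if "K \<le> k" for k
      using that
    proof (induction rule: dec_induct)
      case (step k)
      then show ?case using line_search[of k] long[of k] by simp
    qed simp
    then have "\<gamma> K \<le> norm (d k)" if "K \<le> k" for k using long that by (metis less_imp_le)
    moreover have "\<forall>\<^sub>F k in sequentially. norm (d k) < \<gamma> K"
      using step_tendsto_zero gamma_pos[of K]
      by (intro order_tendstoD(2)[where y = 0]) (auto simp: tendsto_norm_zero_iff)
    ultimately show False
      unfolding eventually_sequentially by (metis linorder_not_le nat_le_linear)
  qed
  then obtain k0 where k0: "K \<le> k0" "norm (d k0) \<le> \<gamma> k0" by blast
  have "norm (d k) \<le> \<gamma> k" if "k0 \<le> k" for k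
    using that
  proof (induction rule: dec_induct)
    case base
    show ?case by (rule k0)
  next
    case (step k)
    then have k: "K \<le> k" "norm (d k) \<le> \<gamma> k" using k0 by auto
    then have "norm (d (Suc k)) \<le> \<nu>\<^sub>\<gamma> * norm (d k)" using K K' by blast
    also have "\<dots> \<le> \<nu>\<^sub>\<gamma> * \<gamma> k" using k(2) params by (intro mult_left_mono) auto
    also have "\<dots> \<le> \<gamma> (Suc k)" using K k by blast
    finally show ?case .
  qed
  then show ?thesis
    unfolding eventually_sequentially using K k0(1) by (meson order_trans)
qed

lemma superlinear_rate:
  assumes "0 < e"
  shows "\<forall>\<^sub>F k in sequentially. norm (stack (x (Suc k)) (y (Suc k)) - stack xs ys)
     \<le> e * norm (stack (x k) (y k) - stack xs ys)"
  using full_step_error[OF assms] unit_steps_eventually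
proof eventually_elim
  case (elim k)
  have "e * norm (x k - xs) \<le> e * norm (stack (x k) (y k) - stack xs ys)"
    using assms by (simp add: stack_arith norm_le_stack)
  then show ?case using elim by (simp add: x_Suc y_Suc stack_arith)
qed

end

section \<open>The subsampled algorithm\<close>

text \<open>This puts stationarity into the form of the right-hand side of the KKT system.\<close>

lemma gradient_lagrangian:
  fixes f :: "real^'n \<Rightarrow> real" and c :: "real^'n \<Rightarrow> real^'m"
  assumes f: "f differentiable (at x)" and c: "\<And>j. (\<lambda>z. c z $ j) differentiable (at x)"
  shows "gradient (\<lambda>z. lagrangian f c z y) x = gradient f x + transpose (jacobian c (at x)) *v y"
proof (rule gradient_eqI)
  have "((\<lambda>z. f z + y \<bullet> c z) has_derivative (\<lambda>h. h \<bullet> gradient f x + y \<bullet> (jacobian c (at x) *v h))) (at x)"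
    by (intro has_derivative_add has_derivative_gradient f
        bounded_linear.has_derivative[OF bounded_linear_inner_right] jacobian_of_components(1) c)
  moreover have "h \<bullet> gradient f x + y \<bullet> (jacobian c (at x) *v h)
      = h \<bullet> (gradient f x + transpose (jacobian c (at x)) *v y)" for h
    by (simp add: inner_add_right dot_lmul_matrix[symmetric] inner_commute)
  ultimately show "GDERIV (\<lambda>z. lagrangian f c z y) x :> gradient f x + transpose (jacobian c (at x)) *v y"
    by (simp only: gderiv_def lagrangian_def)
qed

theorem theorem6p5:
  fixes N :: nat
    and fi :: "nat \<Rightarrow> real^'n \<Rightarrow> real"
    and c :: "real^'n \<Rightarrow> real^'m"
    and f :: "real^'n \<Rightarrow> real"
    and J :: "real^'n \<Rightarrow> real^'n^'m"
    and \<X> :: "(real^'n) set"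
    and Sf Sg SH :: "nat \<Rightarrow> nat set"
    and x :: "nat \<Rightarrow> real^'n" and y :: "nat \<Rightarrow> real^'m"
    and w :: "nat \<Rightarrow> real^('n::finite + 'm::finite)" and ws :: "real^('n::finite + 'm::finite)"
    and xs :: "real^'n" and ys :: "real^'m"
    and fbar :: "nat \<Rightarrow> real^'n \<Rightarrow> real" and gbar :: "nat \<Rightarrow> real^'n"
    and Hbar W Wbar :: "nat \<Rightarrow> real^'n^'n"
    and M Mbar :: "nat \<Rightarrow> real^('n::finite + 'm::finite)^('n::finite + 'm::finite)"
    and dbar :: "nat \<Rightarrow> real^'n" and \<delta>bar :: "nat \<Rightarrow> real^'m"
    and q \<tau> \<gamma> \<alpha> \<epsilon>\<^sub>f \<epsilon>\<^sub>g \<epsilon>\<^sub>A \<beta> :: "nat \<Rightarrow> real"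
    and \<tau>init \<nu>\<^sub>\<alpha> \<nu>\<^sub>\<gamma> \<epsilon>\<^sub>\<tau> \<sigma> \<eta> :: real
    and \<kappa>\<^sub>f \<kappa>\<^sub>g \<kappa>\<^sub>H \<kappa>\<^sub>c \<kappa>\<^sub>J L\<^sub>1 L\<^sub>2 \<Gamma>\<^sub>1 \<Gamma>\<^sub>2 r L\<^sub>L L\<^sub>W :: real
    and \<kappa>\<^sub>0 \<mu>\<^sub>0 \<kappa>\<^sub>1 \<mu>\<^sub>1 \<kappa>\<^sub>2 \<mu>\<^sub>2 \<kappa>\<^sub>W \<zeta> \<Lambda> \<kappa>\<^sub>M \<kappa>\<^sub>d \<mu>\<^sub>M \<kappa>\<^sub>l \<epsilon>\<^sub>H \<kappa>\<^sub>w \<rho>\<^sub>0 :: real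
    and khat :: nat
  assumes dims: "CARD('m) \<le> CARD('n)"
    \<comment> \<open>problem data and standing notation\<close>
    and f_def: "f = (\<lambda>z. average {1..N} (\<lambda>i. fi i z))"
    and J_def: "J = (\<lambda>z. jacobian c (at z))"
    and fi_C2: "\<forall>i\<in>{1..N}. twice_cont_diff_on UNIV (fi i)"
    and c_C2: "\<forall>j. twice_cont_diff_on UNIV (\<lambda>z. c z $ j)"
    and samples: "\<forall>k. Sf k \<noteq> {} \<and> Sf k \<subseteq> {1..N} \<and> Sg k \<noteq> {} \<and> Sg k \<subseteq> {1..N}
                    \<and> SH k \<noteq> {} \<and> SH k \<subseteq> {1..N}"
    and w_def: "\<forall>k. w k = stack (x k) (y k)"
    and ws_def: "ws = stack xs ys"
    and fbar_def: "\<forall>k z. fbar k z = average (Sf k) (\<lambda>i. fi i z)"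
    and gbar_def: "\<forall>k. gbar k = average (Sg k) (\<lambda>i. gradient (fi i) (x k))"
    and Hbar_def: "\<forall>k. Hbar k = average (SH k) (\<lambda>i. hessian (fi i) (x k))"
    and W_def: "\<forall>k. W k = hessian f (x k)
                  + (\<Sum>i\<in>UNIV. (y k $ i) *\<^sub>R hessian (\<lambda>z. c z $ i) (x k))"
    and Wbar_def: "\<forall>k. Wbar k = Hbar k
                  + (\<Sum>i\<in>UNIV. (y k $ i) *\<^sub>R hessian (\<lambda>z. c z $ i) (x k))"
    and M_def: "\<forall>k. M k = kkt_matrix (W k) (J (x k))"
    and Mbar_def: "\<forall>k. Mbar k = kkt_matrix (Wbar k) (J (x k))"
    and eps_f_def: "\<forall>k. \<epsilon>\<^sub>f k = 2 * ((real N - real (card (Sf k))) / real N) * (\<kappa>\<^sub>0 + \<mu>\<^sub>0 * \<kappa>\<^sub>f)"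
    and eps_g_def: "\<forall>k. \<epsilon>\<^sub>g k = 2 * ((real N - real (card (Sg k))) / real N) * (\<kappa>\<^sub>1 + \<mu>\<^sub>1 * \<kappa>\<^sub>g)"
    and eps_A_def: "\<forall>k. \<epsilon>\<^sub>A k =
          \<tau> k * (\<kappa>\<^sub>J * \<kappa>\<^sub>c + inverse \<zeta> * (\<kappa>\<^sub>g + \<epsilon>\<^sub>g k + \<kappa>\<^sub>W * \<kappa>\<^sub>J * \<kappa>\<^sub>c)) * \<epsilon>\<^sub>g k + 2 * \<tau> k * \<epsilon>\<^sub>f k"
    \<comment> \<open>Smoothness\<close>
    and X_set: "open \<X>" "convex \<X>" "\<forall>k. x k \<in> \<X> \<and> x k + dbar k \<in> \<X>"
    and f_smooth: "twice_cont_diff_on \<X> f" "\<forall>z\<in>\<X>. \<bar>f z\<bar> \<le> \<kappa>\<^sub>f"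
    and g_smooth: "L\<^sub>1-lipschitz_on \<X> (gradient f)" "\<forall>z\<in>\<X>. norm (gradient f z) \<le> \<kappa>\<^sub>g"
    and H_smooth: "spectral_lipschitz_on L\<^sub>2 \<X> (hessian f)"
                  "\<forall>z\<in>\<X>. spectral_norm (hessian f z) \<le> \<kappa>\<^sub>H"
    and c_smooth: "\<forall>j. twice_cont_diff_on \<X> (\<lambda>z. c z $ j)" "\<forall>z\<in>\<X>. norm (c z) \<le> \<kappa>\<^sub>c"
    and J_smooth: "bounded (J ` \<X>)" "spectral_lipschitz_on \<Gamma>\<^sub>1 \<X> J"
    and Hc_smooth: "\<forall>j. spectral_lipschitz_on \<Gamma>\<^sub>2 \<X> (hessian (\<lambda>z. c z $ j))"
    and J_sing: "\<exists>s0>0. \<forall>z\<in>\<X>. \<forall>s. singular_value (J z) s \<longrightarrow> s0 \<le> s"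
    and J_pinv: "\<forall>k. spectral_norm (matrix_inv (J (x k) ** transpose (J (x k))) ** J (x k)) \<le> \<kappa>\<^sub>J"
    \<comment> \<open>Lagrangian\<close>
    and stationary: "gradient (\<lambda>z. lagrangian f c z ys) xs = 0" "c xs = 0"
    and r_pos: "r > 0"
    and Lag_grad: "L\<^sub>L-lipschitz_on (ball ws r)
                     (gradient (\<lambda>v. lagrangian f c (primal v) (dual v)))"
    and Lag_hess: "spectral_lipschitz_on L\<^sub>W (ball ws r)
                     (hessian (\<lambda>v. lagrangian f c (primal v) (dual v)))"
    \<comment> \<open>Components\<close>
    and comp_pos: "\<kappa>\<^sub>0 > 0" "\<mu>\<^sub>0 > 0" "\<kappa>\<^sub>1 > 0" "\<mu>\<^sub>1 > 0" "\<kappa>\<^sub>2 > 0" "\<mu>\<^sub>2 > 0"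
    and comp_f: "\<forall>z\<in>\<X>. \<forall>i\<in>{1..N}. \<bar>fi i z\<bar> \<le> \<kappa>\<^sub>0 + \<mu>\<^sub>0 * \<bar>f z\<bar>"
    and comp_g: "\<forall>z\<in>\<X>. \<forall>i\<in>{1..N}. norm (gradient (fi i) z) \<le> \<kappa>\<^sub>1 + \<mu>\<^sub>1 * norm (gradient f z)"
    and comp_H: "\<forall>z\<in>\<X>. \<forall>i\<in>{1..N}.
                   spectral_norm (hessian (fi i) z) \<le> \<kappa>\<^sub>2 + \<mu>\<^sub>2 * spectral_norm (hessian f z)"
    \<comment> \<open>Matrices\<close>
    and mat_pos: "\<kappa>\<^sub>W > 0" "\<zeta> > 0" "\<Lambda> > 0" "\<kappa>\<^sub>M > 0"
    and mat_W: "\<forall>k. spectral_norm (Wbar k) \<le> \<kappa>\<^sub>W"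
    and mat_curv: "\<forall>k u. J (x k) *v u = 0 \<longrightarrow> u \<bullet> (Wbar k *v u) \<ge> \<zeta> * (norm u)\<^sup>2"
    and mat_Minv: "\<forall>k. invertible (Mbar k) \<and> spectral_norm (matrix_inv (Mbar k)) \<le> \<Lambda>"
    and mat_M: "\<forall>k. spectral_norm (Mbar k) \<le> \<kappa>\<^sub>M"
    \<comment> \<open>Growth\<close>
    and growth_pos: "\<kappa>\<^sub>d > 0" "\<mu>\<^sub>M > 0"
    and growth: "\<forall>k d \<delta>.
          unique_solution (M k)
            (- stack (gradient f (x k) + transpose (J (x k)) *v y k) (c (x k))) (stack d \<delta>)
          \<and> norm d \<le> \<kappa>\<^sub>d
          \<longrightarrow> \<mu>\<^sub>M / 2 * norm (w k - ws)
                \<le> norm (stack (gradient f (x k) + transpose (J (x k)) *v y k) (c (x k)))"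
    \<comment> \<open>the algorithm\<close>
    and params: "\<tau>init > 0" "\<gamma> 0 > 0" "\<nu>\<^sub>\<alpha> \<in> {0<..<1}" "\<nu>\<^sub>\<gamma> \<in> {0<..<1}" "\<epsilon>\<^sub>\<tau> \<in> {0<..<1}"
                "\<sigma> \<in> {0<..<1}" "\<eta> \<in> {0<..<1}"
    and step1: "\<forall>k. Mbar k *v stack (dbar k) (\<delta>bar k)
                  = - stack (gbar k + transpose (J (x k)) *v y k) (c (x k))"
    and step2_q: "\<forall>k. q k = gbar k \<bullet> dbar k + max (dbar k \<bullet> (Wbar k *v dbar k)) 0"
    and step2_tau: "\<forall>k. \<tau> k = tau_update \<epsilon>\<^sub>\<tau> (case k of 0 \<Rightarrow> \<tau>init | Suc j \<Rightarrow> \<tau> j)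
                                (tau_trial \<sigma> (q k) (norm1 (c (x k))))"
    and step3: "\<forall>k.
          if norm (dbar k) > \<gamma> k
          then backtracked \<nu>\<^sub>\<alpha> (cond_A (fbar k) c \<eta> (x k) (\<tau> k) (gbar k) (dbar k) (\<epsilon>\<^sub>A k)) (\<alpha> k)
               \<and> \<gamma> (Suc k) = \<gamma> k
          else if cond_A (fbar k) c \<eta> (x k) (\<tau> k) (gbar k) (dbar k) (\<epsilon>\<^sub>A k) 1
          then \<alpha> k = 1 \<and> \<gamma> (Suc k) = \<gamma> k
          else backtracked \<nu>\<^sub>\<alpha>
                 (cond_B (fbar k) c \<eta> (x k) (\<tau> k) (gbar k) (Hbar k) (dbar k) (\<epsilon>\<^sub>A k)) (\<alpha> k)
               \<and> \<gamma> (Suc k) = \<nu>\<^sub>\<gamma> * \<gamma> k"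
    and step4: "\<forall>k. x (Suc k) = x k + \<alpha> k *\<^sub>R dbar k \<and> y (Suc k) = y k + \<delta>bar k"
    and kappa_l: "\<kappa>\<^sub>l > 0"
                 "\<forall>k. model_reduction c (x k) (\<tau> k) (gbar k) (dbar k) \<ge> \<kappa>\<^sub>l * \<tau> k * (norm (dbar k))\<^sup>2"
    \<comment> \<open>conditions on the sample sizes\<close>
    and i: "summable (\<lambda>k. (real N - real (card (Sf k))) / real N)"
    and ii: "summable (\<lambda>k. (real N - real (card (Sg k))) / real N)"
    and iii: "\<forall>k. real (card (SH k)) \<ge> (1 - \<epsilon>\<^sub>H / (2 * (\<kappa>\<^sub>2 + \<mu>\<^sub>2 * \<kappa>\<^sub>H))) * real N"
             "\<epsilon>\<^sub>H < 2 * (1 - \<eta>) * \<kappa>\<^sub>l"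
    and rho_def: "\<rho>\<^sub>0 = Min {\<nu>\<^sub>\<gamma>,
            \<nu>\<^sub>\<gamma>\<^sup>2 * \<mu>\<^sub>M / (4 * \<kappa>\<^sub>M * (1 + 2 * \<kappa>\<^sub>J * \<kappa>\<^sub>W) * max (2 * \<Lambda> * L\<^sub>L) \<nu>\<^sub>\<gamma>),
            \<mu>\<^sub>M * \<Lambda> / 2}"
    and iv: "\<forall>k\<ge>khat. real (card (Sg k)) \<ge>
               (1 - \<kappa>\<^sub>w * \<rho>\<^sub>0 * \<beta> (k - khat) powr (real (k - khat) / 2)
                     / (4 * \<Lambda> * (\<kappa>\<^sub>1 + \<mu>\<^sub>1 * \<kappa>\<^sub>g))) * real N"
            "\<kappa>\<^sub>w > 0" "\<forall>t\<ge>1. \<beta> t < \<beta> (t - 1)" "\<beta> \<longlonglongrightarrow> 0" "\<beta> 1 \<le> \<rho>\<^sub>0 ^ 4"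
    and v: "\<forall>k\<ge>khat. (card (SH k) < N \<longrightarrow> card (SH (Suc k)) > card (SH k))
                       \<and> (card (SH k) = N \<longrightarrow> card (SH (Suc k)) = N)"
           "(\<lambda>k. real (card (SH k))) \<longlonglongrightarrow> real N"
           "real (card (SH khat)) \<ge>
              max ((8 * \<Lambda> * (\<kappa>\<^sub>2 + \<mu>\<^sub>2 * \<kappa>\<^sub>H) - \<rho>\<^sub>0) / (8 * \<Lambda> * (\<kappa>\<^sub>2 + \<mu>\<^sub>2 * \<kappa>\<^sub>H)) * real N) 1"
  shows "(\<lambda>k. norm (w k - ws)) \<longlonglongrightarrow> 0
    \<and> (\<exists>\<xi> :: nat \<Rightarrow> real. (\<forall>k. \<xi> k > 0) \<and> (\<forall>k. norm (w k - ws) \<le> \<xi> k)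
          \<and> (\<lambda>k. \<xi> (Suc k) / \<xi> k) \<longlonglongrightarrow> 0)"
proof -
  have N: "0 < N" using samples[rule_format, of 0] by (cases N) auto
  have full_of_summable: "\<forall>\<^sub>F k in sequentially. S k = {1..N}"
    if sub: "\<And>k. S k \<subseteq> {1..N}" and "summable (\<lambda>k. (real N - real (card (S k))) / real N)"
    for S :: "nat \<Rightarrow> nat set"
  proof (rule full_sample_eventually[OF sub])
    have "(\<lambda>k. real N - real N * ((real N - real (card (S k))) / real N)) \<longlonglongrightarrow> real N - real N * 0"
      by (intro tendsto_intros summable_LIMSEQ_zero that)
    then show "(\<lambda>k. real (card (S k))) \<longlonglongrightarrow> real N" using N by simp
  qed
  have "\<forall>\<^sub>F k in sequentially. Sf k = {1..N} \<and> Sg k = {1..N} \<and> SH k = {1..N}"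
    using samples i ii v(2)
    by (intro eventually_conj full_of_summable full_sample_eventually) auto
  then obtain K where K: "\<And>k. K \<le> k \<Longrightarrow> Sf k = {1..N}" "\<And>k. K \<le> k \<Longrightarrow> Sg k = {1..N}"
      "\<And>k. K \<le> k \<Longrightarrow> SH k = {1..N}"
    unfolding eventually_sequentially by blast

  have f_sum: "f = (\<lambda>z. (1 / real N) *\<^sub>R (\<Sum>i\<in>{1..N}. fi i z))"
    unfolding f_def average_full ..
  have fi: "\<And>i. i \<in> {1..N} \<Longrightarrow> twice_cont_diff_on UNIV (fi i)" using fi_C2 by blast
  have f_C2: "twice_cont_diff_on UNIV f"
    unfolding f_sum by (rule twice_cont_diff_sum(1)[OF fi])
  have gf: "gradient f z = average {1..N} (\<lambda>i. gradient (fi i) z)" for z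
    unfolding f_sum average_full by (rule twice_cont_diff_sum(2)[OF fi])
  have hf: "hessian f z = average {1..N} (\<lambda>i. hessian (fi i) z)" for z
    unfolding f_sum average_full by (rule twice_cont_diff_sum(3)[OF fi])

  have lower: "norm z \<le> \<Lambda> * norm (kkt_matrix (Wbar k) (J (x k)) *v z)" for k z
    using invertible_lower_bound mat_Minv Mbar_def by metis
  have upper: "norm (kkt_matrix (Wbar k) (J (x k)) *v z) \<le> \<kappa>\<^sub>M * norm z" for k z
    using mat_M Mbar_def norm_mult_vec_le_spectral
    by (metis mult_right_mono norm_ge_zero order_trans)
  have inv: "invertible (kkt_matrix (Wbar k) (J (x k)))" for k
    using mat_Minv Mbar_def by metis
  have curv: "0 \<le> u \<bullet> (Wbar k *v u)" if "J (x k) *v u = 0" for k u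
  proof -
    have "0 \<le> \<zeta> * (norm u)\<^sup>2" using mat_pos(2) by simp
    also have "\<dots> \<le> u \<bullet> (Wbar k *v u)" using mat_curv that by blast
    finally show ?thesis .
  qed
  have sys: "kkt_matrix (Wbar k) (J (x k)) *v stack (dbar k) (\<delta>bar k)
      = - stack (gbar k + transpose (J (x k)) *v y k) (c (x k))" for k
    using step1 Mbar_def by metis

  (* Before K the samples are arbitrary, so only positivity can be carried over to K: there the
     constant C depends on k. *)
  have tau_pos: "0 < \<tau> k" for k
  proof -
    have upd: "0 < \<tau> k" if \<tau>: "\<tau> k = tau_update \<epsilon>\<^sub>\<tau> t (tau_trial \<sigma> (q k) (norm1 (c (x k))))" and t: "0 < t" for t k
    proof -
      define C where "C = norm (y k + \<delta>bar k) + \<kappa>\<^sub>M * \<Lambda> * (2 * norm (dbar k) + \<Lambda> * norm (c (x k)))"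
      have C: "0 \<le> C" unfolding C_def using mat_pos by simp
      have "q k \<le> C * norm (c (x k))"
        unfolding C_def step2_q[rule_format]
        by (rule kkt_quotient_bound[OF lower upper sys inv curv])
      also have "\<dots> \<le> (C + 1) * norm1 (c (x k))"
        using C by (intro mult_mono norm_le_norm1) auto
      finally have "q k \<le> (C + 1) * norm1 (c (x k))" .
      then show ?thesis
        unfolding \<tau> using t params C by (intro tau_update_bounds(3)[where C = "C + 1"]) (auto simp: norm1_nonneg)
    qed
    show ?thesis
    proof (induction k)
      case 0
      show ?case by (rule upd[where t = \<tau>init]) (use step2_tau[rule_format, of 0] params in auto)
    next
      case (Suc k)
      show ?case by (rule upd[where t = "\<tau> k"]) (use step2_tau[rule_format, of "Suc k"] Suc in auto)
    qed
  qed
  have gamma_pos: "0 < \<gamma> k" for k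
  proof (induction k)
    case (Suc k)
    then show ?case using step3[rule_format, of k] params by (auto split: if_splits)
  qed (rule params)

  have exact: "fbar k = f" "gbar k = gradient f (x k)" "Hbar k = hessian f (x k)" "Wbar k = W k" "\<epsilon>\<^sub>A k = 0"
    if "K \<le> k" for k
  proof -
    show "fbar k = f" using K(1)[OF that] fbar_def f_def by auto
    show "gbar k = gradient f (x k)" using K(2)[OF that] gbar_def gf by simp
    show "Hbar k = hessian f (x k)" using K(3)[OF that] Hbar_def hf by simp
    then show "Wbar k = W k" using Wbar_def W_def by simp
    show "\<epsilon>\<^sub>A k = 0" using K(1,2)[OF that] eps_A_def eps_f_def eps_g_def by simp
  qed

  have W_shift: "kkt_matrix (W (k + K)) (J (x (k + K))) = kkt_matrix (Wbar (k + K)) (J (x (k + K)))" for k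
    by (simp add: exact)
  have c_C2': "twice_cont_diff_on UNIV (\<lambda>z. c z $ j)" for j using c_C2 by blast
  have W_K: "W (k + K) = hessian f (x (k + K))
      + (\<Sum>i\<in>UNIV. (y (k + K) $ i) *\<^sub>R hessian (\<lambda>z. c z $ i) (x (k + K)))" for k
    using W_def by blast
  have sys_K: "kkt_matrix (W (k + K)) (J (x (k + K))) *v stack (dbar (k + K)) (\<delta>bar (k + K))
      = - stack (gradient f (x (k + K)) + transpose (J (x (k + K))) *v y (k + K)) (c (x (k + K)))" for k
    using sys[of "k + K"] by (simp only: exact le_add2)
  have curv_K: "0 \<le> u \<bullet> (W (k + K) *v u)" if "J (x (k + K)) *v u = 0" for k u
    using curv[OF that] by (simp add: exact)
  have tau_K: "\<tau> (Suc k + K) = tau_update \<epsilon>\<^sub>\<tau> (\<tau> (k + K)) (tau_trial \<sigma>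
      (gradient f (x (Suc k + K)) \<bullet> dbar (Suc k + K)
        + max (dbar (Suc k + K) \<bullet> (W (Suc k + K) *v dbar (Suc k + K))) 0)
      (norm1 (c (x (Suc k + K)))))" for k
    using step2_tau[rule_format, of "Suc k + K"] step2_q[rule_format, of "Suc k + K"]
    by (simp add: exact)
  have ls_K: "if norm (dbar (k + K)) > \<gamma> (k + K)
      then backtracked \<nu>\<^sub>\<alpha> (cond_A f c \<eta> (x (k + K)) (\<tau> (k + K)) (gradient f (x (k + K))) (dbar (k + K)) 0)
             (\<alpha> (k + K)) \<and> \<gamma> (Suc k + K) = \<gamma> (k + K)
      else if cond_A f c \<eta> (x (k + K)) (\<tau> (k + K)) (gradient f (x (k + K))) (dbar (k + K)) 0 1
      then \<alpha> (k + K) = 1 \<and> \<gamma> (Suc k + K) = \<gamma> (k + K)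
      else backtracked \<nu>\<^sub>\<alpha> (cond_B f c \<eta> (x (k + K)) (\<tau> (k + K)) (gradient f (x (k + K)))
             (hessian f (x (k + K))) (dbar (k + K)) 0) (\<alpha> (k + K))
           \<and> \<gamma> (Suc k + K) = \<nu>\<^sub>\<gamma> * \<gamma> (k + K)" for k
    using step3[rule_format, of "k + K"] by (simp only: exact le_add2 add_Suc)
  have steps_K: "x (Suc k + K) = x (k + K) + \<alpha> (k + K) *\<^sub>R dbar (k + K)"
    "y (Suc k + K) = y (k + K) + \<delta>bar (k + K)" for k
    using step4 by simp_all
  have red_K: "\<kappa>\<^sub>l * \<tau> (k + K) * (norm (dbar (k + K)))\<^sup>2
      \<le> model_reduction c (x (k + K)) (\<tau> (k + K)) (gradient f (x (k + K))) (dbar (k + K))" for k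
    using kappa_l(2)[rule_format, of "k + K"] by (simp add: exact)
  have stat: "gradient f xs + transpose (J xs) *v ys = 0"
    using stationary(1) f_C2 c_C2'
    by (subst (asm) gradient_lagrangian) (auto simp: twice_cont_diff_on_def J_def)
  have growth_K: "\<mu>\<^sub>M / 2 * norm (stack (x (k + K)) (y (k + K)) - stack xs ys)
      \<le> norm (stack (gradient f (x (k + K)) + transpose (J (x (k + K))) *v y (k + K)) (c (x (k + K))))"
    if "norm (dbar (k + K)) \<le> \<kappa>\<^sub>d" for k
  proof -
    have "unique_solution (M (k + K))
        (- stack (gradient f (x (k + K)) + transpose (J (x (k + K))) *v y (k + K)) (c (x (k + K))))
        (stack (dbar (k + K)) (\<delta>bar (k + K)))"
      unfolding unique_solution_def M_def[rule_format] sys_K[symmetric]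
    proof (intro conjI refl allI impI)
      fix s'
      let ?s = "stack (dbar (k + K)) (\<delta>bar (k + K))"
      assume "kkt_matrix (W (k + K)) (J (x (k + K))) *v s' = kkt_matrix (W (k + K)) (J (x (k + K))) *v ?s"
      then have "kkt_matrix (W (k + K)) (J (x (k + K))) *v (s' - ?s) = 0"
        by (simp add: matrix_vector_mult_diff_distrib)
      then have "norm (s' - ?s) \<le> 0"
        using lower[of "s' - ?s" "k + K"] by (simp add: W_shift)
      then show "s' = ?s" by simp
    qed
    then show ?thesis
      using growth[rule_format, of "k + K"] that w_def ws_def by metis
  qed

  interpret S: exact_sqp_growth where f = f and c = c and X = \<X> and J = J
    and W = "\<lambda>k. W (k + K)" and x = "\<lambda>k. x (k + K)" and d = "\<lambda>k. dbar (k + K)"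
    and y = "\<lambda>k. y (k + K)" and \<delta> = "\<lambda>k. \<delta>bar (k + K)" and \<tau> = "\<lambda>k. \<tau> (k + K)"
    and \<gamma> = "\<lambda>k. \<gamma> (k + K)" and \<alpha> = "\<lambda>k. \<alpha> (k + K)" and xs = xs and ys = ys and \<mu> = "\<mu>\<^sub>M / 2"
    and \<kappa>\<^sub>f = \<kappa>\<^sub>f and \<kappa>\<^sub>g = \<kappa>\<^sub>g and \<kappa>\<^sub>c = \<kappa>\<^sub>c and L\<^sub>1 = L\<^sub>1 and L\<^sub>2 = L\<^sub>2
    and \<Gamma>\<^sub>1 = \<Gamma>\<^sub>1 and \<Gamma>\<^sub>2 = \<Gamma>\<^sub>2 and \<Lambda> = \<Lambda> and \<kappa>\<^sub>M = \<kappa>\<^sub>M and \<nu>\<^sub>\<alpha> = \<nu>\<^sub>\<alpha> and \<nu>\<^sub>\<gamma> = \<nu>\<^sub>\<gamma>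
    and \<epsilon>\<^sub>\<tau> = \<epsilon>\<^sub>\<tau> and \<sigma> = \<sigma> and \<eta> = \<eta> and \<kappa>\<^sub>l = \<kappa>\<^sub>l and \<kappa>\<^sub>d = \<kappa>\<^sub>d
    by (unfold_locales;
        (rule J_def W_K f_C2 c_C2' X_set steps_K stat stationary growth_pos growth_K red_K ls_K tau_K
           sys_K curv_K g_smooth H_smooth J_smooth Hc_smooth[rule_format] kappa_l)?;
        (use X_set f_smooth g_smooth c_smooth tau_pos gamma_pos params growth_pos inv lower upper
           in \<open>simp add: W_shift\<close>)?)

  let ?u = "\<lambda>k. norm (w k - ws)"
  have u: "norm (stack (x k) (y k) - stack xs ys) = ?u k" for k
    by (simp add: w_def ws_def)
  have "(\<lambda>k. ?u (k + K)) \<longlonglongrightarrow> 0"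
    using S.iterates_converge unfolding u .
  then have "?u \<longlonglongrightarrow> 0" by (rule LIMSEQ_offset)
  moreover have "\<forall>\<^sub>F k in sequentially. ?u (Suc k) \<le> e * ?u k" if "0 < e" for e
  proof -
    have "\<forall>\<^sub>F k in sequentially. ?u (Suc (k + K)) \<le> e * ?u (k + K)"
      using S.superlinear_rate[OF that] unfolding u add_Suc .
    then show ?thesis by (rule eventually_sequentially_seg[THEN iffD1])
  qed
  ultimately show ?thesis using superlinear_majorant[of ?u] by simp
qed

end
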